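(* Let $\mathcal G$ be a connected groupoid (a small category, with an arbitrary, possibly infinite, set of objects), let $x$ be a fixed object of $\mathcal G$ and let $G$ be the group of loops $l$ in $\mathcal G$ with $s(l)=t(l)=x$. If $B$ is the groupoid algebra of $\mathcal G$ over a field $\mathbb K$ of characteristic zero, then $$\mathrm{HC}_\ast(B)\cong\mathrm{HC}_\ast(\mathbb KG).$$
   Context: A groupoid $\mathcal G$ with object set $\mathcal G^0$, morphism set $\mathcal G^1$, source $s$ and target $t$ is connected if for any $x,y\in\mathcal G^0$ there is $g\in\mathcal G^1$ with $s(g)=x$, $t(g)=y$. The groupoid algebra $B=\mathbb K\mathcal G^1$ has basis $\mathcal G^1$ and product $gg'=g\circ g'$ if $s(g)=t(g')$ and $0$ otherwise; it is not unital if $\mathcal G^0$ is infinite. Cyclic homology $\mathrm{HC}_\ast(B)$ of a possibly non-unital algebra is defined as the homology of Connes' complex $C^\lambda_\ast(B)$: $C^\lambda_n(B)$ is the quotient of $B^{\otimes_{\mathbb K}\,n+1}$ by the image of $1-\tau_n$, where $\tau_n(b_0\otimes\dots\otimes b_n)=(-1)^nb_n\otimes b_0\otimes\dots\otimes b_{n-1}$, with differential induced by the Hochschild boundary $\sum_{k=0}^n(-1)^kd_k$, where $d_k$ multiplies $b_k$ and $b_{k+1}$ for $k<n$ and $d_n(b_0\otimes\dots\otimes b_n)=b_nb_0\otimes b_1\otimes\dots\otimes b_{n-1}$. *)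

theory Defs
  imports Complex_Main "HOL-Algebra.Group" "HOL-Library.Poly_Mapping"
begin

section \<open>Groupoids\<close>

record ('o, 'm) small_category =
  Obj :: "'o set"
  Arr :: "'m set"
  Src :: "'m \<Rightarrow> 'o"
  Tgt :: "'m \<Rightarrow> 'o"
  Comp :: "'m \<Rightarrow> 'm \<Rightarrow> 'm"
  Ident :: "'o \<Rightarrow> 'm"

text \<open>The composite \<open>Comp C g h\<close> means "first h, then g"; it is meaningful only
  if the source of \<open>g\<close> is the target of \<open>h\<close>.\<close>

locale small_category =
  fixes C :: "('o, 'm) small_category"
  assumes Src_Obj: "g \<in> Arr C \<Longrightarrow> Src C g \<in> Obj C"
    and Tgt_Obj: "g \<in> Arr C \<Longrightarrow> Tgt C g \<in> Obj C"
    and Ident_Arr: "x \<in> Obj C \<Longrightarrow> Ident C x \<in> Arr C"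
    and Src_Ident: "x \<in> Obj C \<Longrightarrow> Src C (Ident C x) = x"
    and Tgt_Ident: "x \<in> Obj C \<Longrightarrow> Tgt C (Ident C x) = x"
    and Comp_Arr: "\<lbrakk>g \<in> Arr C; h \<in> Arr C; Src C g = Tgt C h\<rbrakk> \<Longrightarrow> Comp C g h \<in> Arr C"
    and Src_Comp: "\<lbrakk>g \<in> Arr C; h \<in> Arr C; Src C g = Tgt C h\<rbrakk> \<Longrightarrow> Src C (Comp C g h) = Src C h"
    and Tgt_Comp: "\<lbrakk>g \<in> Arr C; h \<in> Arr C; Src C g = Tgt C h\<rbrakk> \<Longrightarrow> Tgt C (Comp C g h) = Tgt C g"
    and Comp_assoc: "\<lbrakk>f \<in> Arr C; g \<in> Arr C; h \<in> Arr C; Src C f = Tgt C g; Src C g = Tgt C h\<rbrakk>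
          \<Longrightarrow> Comp C (Comp C f g) h = Comp C f (Comp C g h)"
    and Comp_Ident_left: "g \<in> Arr C \<Longrightarrow> Comp C (Ident C (Tgt C g)) g = g"
    and Comp_Ident_right: "g \<in> Arr C \<Longrightarrow> Comp C g (Ident C (Src C g)) = g"

locale groupoid = small_category +
  assumes inverse: "g \<in> Arr C \<Longrightarrow> \<exists>h\<in>Arr C. Src C h = Tgt C g \<and> Tgt C h = Src C g \<and>
            Comp C h g = Ident C (Src C g) \<and> Comp C g h = Ident C (Tgt C g)"

definition connected_category :: "('o, 'm) small_category \<Rightarrow> bool" where
  "connected_category C \<longleftrightarrow>
     (\<forall>x\<in>Obj C. \<forall>y\<in>Obj C. \<exists>g\<in>Arr C. Src C g = x \<and> Tgt C g = y)"

definition loop_group :: "('o, 'm) small_category \<Rightarrow> 'o \<Rightarrow> 'm monoid" where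
  "loop_group C x =
     \<lparr>carrier = {l \<in> Arr C. Src C l = x \<and> Tgt C l = x}, mult = Comp C, one = Ident C x\<rparr>"

lemma (in groupoid) group_loop_group:
  assumes "x \<in> Obj C"
  shows "group (loop_group C x)"
proof (rule groupI)
  fix g assume "g \<in> carrier (loop_group C x)"
  then have g: "g \<in> Arr C" "Src C g = x" "Tgt C g = x"
    by (auto simp: loop_group_def)
  from inverse[OF g(1)] g
  show "\<exists>h\<in>carrier (loop_group C x). h \<otimes>\<^bsub>loop_group C x\<^esub> g = \<one>\<^bsub>loop_group C x\<^esub>"
    by (auto simp: loop_group_def)
next
  fix g assume "g \<in> carrier (loop_group C x)"
  then show "\<one>\<^bsub>loop_group C x\<^esub> \<otimes>\<^bsub>loop_group C x\<^esub> g = g"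
    using Comp_Ident_left[of g] by (auto simp: loop_group_def)
qed (use assms in \<open>auto simp: loop_group_def Ident_Arr Src_Ident Tgt_Ident Comp_Arr
       Src_Comp Tgt_Comp Comp_assoc\<close>)


section \<open>Vector spaces and their quotients\<close>

record ('k, 'v) vspace = "'v partial_object" +
  vzero :: "'v"
  vadd :: "'v \<Rightarrow> 'v \<Rightarrow> 'v"
  vscale :: "'k \<Rightarrow> 'v \<Rightarrow> 'v"

definition vcoset :: "('k, 'v, 'z) vspace_scheme \<Rightarrow> 'v set \<Rightarrow> 'v \<Rightarrow> 'v set" where
  "vcoset V W v = vadd V v ` W"

definition vquot :: "('k, 'v, 'z) vspace_scheme \<Rightarrow> 'v set \<Rightarrow> ('k, 'v set) vspace" where
  "vquot V W =
     \<lparr>carrier = vcoset V W ` carrier V,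
      vzero = W,
      vadd = (\<lambda>X Y. \<Union>x\<in>X. \<Union>y\<in>Y. vcoset V W (vadd V x y)),
      vscale = (\<lambda>c X. \<Union>x\<in>X. vcoset V W (vscale V c x))\<rparr>"

text \<open>The map into the quotient of \<open>V'\<close> by \<open>W'\<close> induced by \<open>f\<close> on a quotient of \<open>V\<close>:
  when \<open>f\<close> is compatible with the quotients, all cosets in the union coincide.\<close>

definition induced ::
  "('k, 'v, 'z) vspace_scheme \<Rightarrow> 'v set \<Rightarrow> ('u \<Rightarrow> 'v) \<Rightarrow> 'u set \<Rightarrow> 'v set" where
  "induced V' W' f X = (\<Union>x\<in>X. vcoset V' W' (f x))"

definition vspace_iso ::
  "('k, 'v, 'y) vspace_scheme \<Rightarrow> ('k, 'w, 'z) vspace_scheme \<Rightarrow> bool" (infix "\<cong>\<^sub>v" 50) where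
  "V \<cong>\<^sub>v W \<longleftrightarrow> (\<exists>f. bij_betw f (carrier V) (carrier W) \<and>
     (\<forall>x\<in>carrier V. \<forall>y\<in>carrier V. f (vadd V x y) = vadd W (f x) (f y)) \<and>
     (\<forall>c. \<forall>x\<in>carrier V. f (vscale V c x) = vscale W c (f x)))"


section \<open>Free vector spaces and algebras given by a basis\<close>

definition pm_scale :: "'k::field \<Rightarrow> ('a \<Rightarrow>\<^sub>0 'k) \<Rightarrow> ('a \<Rightarrow>\<^sub>0 'k)" where
  "pm_scale c f = Poly_Mapping.map ((*) c) f"

lemma lookup_pm_scale: "Poly_Mapping.lookup (pm_scale c f) x = c * Poly_Mapping.lookup f x"
  by (simp add: pm_scale_def Poly_Mapping.map.rep_eq when_def)

global_interpretation pm: vector_space "pm_scale :: 'k::field \<Rightarrow> ('a \<Rightarrow>\<^sub>0 'k) \<Rightarrow> ('a \<Rightarrow>\<^sub>0 'k)"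
  by standard
    (auto intro!: poly_mapping_eqI simp: lookup_pm_scale lookup_add algebra_simps)

definition free_vspace :: "'a set \<Rightarrow> ('k::field, 'a \<Rightarrow>\<^sub>0 'k) vspace" where
  "free_vspace S = \<lparr>carrier = {f. Poly_Mapping.keys f \<subseteq> S}, vzero = 0, vadd = (+), vscale = pm_scale\<rparr>"

definition lin_ext :: "('a \<Rightarrow> ('b \<Rightarrow>\<^sub>0 'k::field)) \<Rightarrow> ('a \<Rightarrow>\<^sub>0 'k) \<Rightarrow> ('b \<Rightarrow>\<^sub>0 'k)" where
  "lin_ext \<phi> f = (\<Sum>a\<in>Poly_Mapping.keys f. pm_scale (Poly_Mapping.lookup f a) (\<phi> a))"

text \<open>Algebras need not be unital, so no unit is recorded.\<close>

record ('k, 'v) kalgebra = "('k, 'v) vspace" +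
  vmult :: "'v \<Rightarrow> 'v \<Rightarrow> 'v"

text \<open>The algebra with basis \<open>S\<close> in which the product of basis elements \<open>a\<close>, \<open>b\<close> is \<open>\<mu> a b\<close>.\<close>

definition basis_algebra ::
  "'a set \<Rightarrow> ('a \<Rightarrow> 'a \<Rightarrow> ('a \<Rightarrow>\<^sub>0 'k::field)) \<Rightarrow> ('k, 'a \<Rightarrow>\<^sub>0 'k) kalgebra" where
  "basis_algebra S \<mu> =
     vspace.extend (free_vspace S)
       (kalgebra.fields (\<lambda>f g. lin_ext (\<lambda>a. lin_ext (\<lambda>b. \<mu> a b) g) f))"

definition groupoid_algebra ::
  "('o, 'm) small_category \<Rightarrow> ('k::field, 'm \<Rightarrow>\<^sub>0 'k) kalgebra" where
  "groupoid_algebra C =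
     basis_algebra (Arr C)
       (\<lambda>g h. if Src C g = Tgt C h then Poly_Mapping.single (Comp C g h) 1 else 0)"

definition group_algebra :: "'g monoid \<Rightarrow> ('k::field, 'g \<Rightarrow>\<^sub>0 'k) kalgebra" where
  "group_algebra G = basis_algebra (carrier G) (\<lambda>g h. Poly_Mapping.single (g \<otimes>\<^bsub>G\<^esub> h) 1)"


section \<open>Tensor powers\<close>

text \<open>A list \<open>[b\<^sub>0, \<dots>, b\<^sub>n]\<close> stands for the pure tensor of its entries. The tensor power with
  \<open>n + 1\<close> factors is the free vector space on such lists modulo multilinearity.\<close>

definition tuples :: "('k, 'b, 'z) vspace_scheme \<Rightarrow> nat \<Rightarrow> 'b list set" where
  "tuples B n = {bs. length bs = Suc n \<and> set bs \<subseteq> carrier B}"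

definition tensor_relations ::
  "('k::field, 'b, 'z) vspace_scheme \<Rightarrow> nat \<Rightarrow> ('b list \<Rightarrow>\<^sub>0 'k) set" where
  "tensor_relations B n = pm.span
     ({Poly_Mapping.single (xs @ vadd B a b # ys) 1
         - Poly_Mapping.single (xs @ a # ys) 1 - Poly_Mapping.single (xs @ b # ys) 1 |xs ys a b.
         length xs + length ys = n \<and> set xs \<union> set ys \<union> {a, b} \<subseteq> carrier B} \<union>
      {Poly_Mapping.single (xs @ vscale B c a # ys) 1 - Poly_Mapping.single (xs @ a # ys) c |xs ys a c.
         length xs + length ys = n \<and> set xs \<union> set ys \<union> {a} \<subseteq> carrier B})"

definition tensor_power ::
  "('k::field, 'b, 'z) vspace_scheme \<Rightarrow> nat \<Rightarrow> ('k, ('b list \<Rightarrow>\<^sub>0 'k) set) vspace" where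
  "tensor_power B n = vquot (free_vspace (tuples B n)) (tensor_relations B n)"

text \<open>The linear map into \<open>tensor_power B n\<close> determined by its values \<open>\<phi>\<close> on pure tensors.\<close>

definition tensor_map ::
  "('k::field, 'b, 'z) vspace_scheme \<Rightarrow> nat \<Rightarrow> ('b list \<Rightarrow> ('b list \<Rightarrow>\<^sub>0 'k))
    \<Rightarrow> ('b list \<Rightarrow>\<^sub>0 'k) set \<Rightarrow> ('b list \<Rightarrow>\<^sub>0 'k) set" where
  "tensor_map B n \<phi> = induced (free_vspace (tuples B n)) (tensor_relations B n) (lin_ext \<phi>)"


section \<open>Connes' complex and cyclic homology\<close>

definition cyclic_operator ::
  "('k::field, 'b, 'z) vspace_scheme \<Rightarrow> nat \<Rightarrow> ('b list \<Rightarrow>\<^sub>0 'k) set \<Rightarrow> ('b list \<Rightarrow>\<^sub>0 'k) set" where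
  "cyclic_operator B n =
     tensor_map B n (\<lambda>bs. Poly_Mapping.single (last bs # butlast bs) ((-1) ^ n))"

definition face :: "('k, 'b, 'z) kalgebra_scheme \<Rightarrow> nat \<Rightarrow> nat \<Rightarrow> 'b list \<Rightarrow> 'b list" where
  "face B n k bs =
     (if k < n then take k bs @ vmult B (bs ! k) (bs ! Suc k) # drop (k + 2) bs
      else vmult B (bs ! n) (bs ! 0) # tl (butlast bs))"

text \<open>\<open>hochschild_boundary B n\<close> goes from the tensor power in degree \<open>n + 1\<close>
  (that is, with \<open>n + 2\<close> factors) to the one in degree \<open>n\<close>; likewise \<open>connes_boundary B n\<close>.\<close>

definition hochschild_boundary ::
  "('k::field, 'b, 'z) kalgebra_scheme \<Rightarrow> nat \<Rightarrow> ('b list \<Rightarrow>\<^sub>0 'k) set \<Rightarrow> ('b list \<Rightarrow>\<^sub>0 'k) set" where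
  "hochschild_boundary B n =
     tensor_map B n (\<lambda>bs. \<Sum>k\<le>Suc n. Poly_Mapping.single (face B (Suc n) k bs) ((-1) ^ k))"

definition cyclic_relations ::
  "('k::field, 'b, 'z) vspace_scheme \<Rightarrow> nat \<Rightarrow> ('b list \<Rightarrow>\<^sub>0 'k) set set" where
  "cyclic_relations B n =
     (let T = tensor_power B n
      in (\<lambda>t. vadd T t (vscale T (-1) (cyclic_operator B n t))) ` carrier T)"

definition connes_space ::
  "('k::field, 'b, 'z) vspace_scheme \<Rightarrow> nat \<Rightarrow> ('k, ('b list \<Rightarrow>\<^sub>0 'k) set set) vspace" where
  "connes_space B n = vquot (tensor_power B n) (cyclic_relations B n)"

definition connes_boundary ::
  "('k::field, 'b, 'z) kalgebra_scheme \<Rightarrow> nat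
    \<Rightarrow> ('b list \<Rightarrow>\<^sub>0 'k) set set \<Rightarrow> ('b list \<Rightarrow>\<^sub>0 'k) set set" where
  "connes_boundary B n =
     induced (tensor_power B n) (cyclic_relations B n) (hochschild_boundary B n)"

definition connes_cycles ::
  "('k::field, 'b, 'z) kalgebra_scheme \<Rightarrow> nat \<Rightarrow> ('b list \<Rightarrow>\<^sub>0 'k) set set set" where
  "connes_cycles B n =
     (case n of
        0 \<Rightarrow> carrier (connes_space B 0)
      | Suc m \<Rightarrow> {z \<in> carrier (connes_space B (Suc m)).
                    connes_boundary B m z = vzero (connes_space B m)})"

definition HC ::
  "nat \<Rightarrow> ('k::field, 'b, 'z) kalgebra_scheme \<Rightarrow> ('k, ('b list \<Rightarrow>\<^sub>0 'k) set set set) vspace" where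
  "HC n B = vquot ((connes_space B n)\<lparr>carrier := connes_cycles B n\<rparr>)
                  (connes_boundary B n ` carrier (connes_space B (Suc n)))"

end

theory Submission
  imports Defs
begin

text \<open>
  Fix paths from \<open>x\<close> to all objects. A cyclic word of arrows is then a cyclic word of letters \<open>(v, l)\<close>
  with \<open>l\<close> a loop at \<open>x\<close> and \<open>v = (p, q)\<close> the junction before the arrow: the source \<open>p\<close> of the preceding
  arrow and the target \<open>q\<close> of the arrow itself. Replacing a letter \<open>(v, l)\<close> by
  \<open>(v, 1) \<otimes> (\<star>, l) - \<epsilon>(v) (\<star>, 1) \<otimes> (\<star>, l)\<close>, where \<open>\<star> = (x, x)\<close> and \<open>\<epsilon>\<close> indicates diagonal junctions,
  with alternating signs over all positions, is a null-homotopy of the operator \<open>Num\<close> that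
  counts junctions in the kernel of the augmentation \<open>\<epsilon>\<close>. In characteristic zero \<open>Num\<close> is invertible
  away from the words with trivial junctions, and these are the words of the group algebra; so every
  cycle is homologous to its generalized trace. All subspaces of the Connes complex are handled
  through the cochains annihilating them, which turns the statements on cyclic homology into
  identities between scalar functions on words.
\<close>

section \<open>Linear functionals on free vector spaces\<close>

text \<open>With infinitely many objects \<open>B\<close> has no unit, so a homotopy cannot insert 1
  into a word; the letters supply a substitute. Put u = (\<open>star\<close>, \<open>e\<close>).
  Then b u = b and u (v, l) = \<open>eps v\<close> (\<open>star\<close>, l), so the projection P(b)
  = b u - u b onto the kernel of the augmentation is an inner derivation. \<open>Num\<close> is its
  extension to words, and inner derivations act trivially on cyclic homology. The homotopy realising
  this splits P(v, l) into the factors P(v, \<open>e\<close>) and (\<open>star\<close>, l); it is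
  tractable because every product b P(c) is zero.

  \<open>B\<close> itself is not the letter algebra: a junction involves the preceding arrow, so
  only cyclic words translate. Words of arrows that do not compose occur in the tensor powers too;
  their nondiagonal junctions are among those that \<open>Num\<close> counts.

  Passing to annihilators loses nothing, since over a field every subspace is the common kernel of
  the functionals vanishing on it. The isomorphism is induced by including loops among arrows; the
  trace of a cycle serves to show that this map is onto.\<close>

definition ev :: "('a \<Rightarrow> 'k::field) \<Rightarrow> ('a \<Rightarrow>\<^sub>0 'k) \<Rightarrow> 'k" where
  "ev \<phi> f = (\<Sum>a\<in>Poly_Mapping.keys f. Poly_Mapping.lookup f a * \<phi> a)"

lemma ev_superset:
  assumes "finite A" "Poly_Mapping.keys f \<subseteq> A"
  shows "ev \<phi> f = (\<Sum>a\<in>A. Poly_Mapping.lookup f a * \<phi> a)"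
  unfolding ev_def using assms
  by (intro sum.mono_neutral_left) (auto simp: in_keys_iff)

lemma ev_zero [simp]: "ev \<phi> 0 = 0"
  by (simp add: ev_def)

lemma ev_add: "ev \<phi> (f + g) = ev \<phi> f + ev \<phi> g"
proof -
  let ?A = "Poly_Mapping.keys f \<union> Poly_Mapping.keys g"
  have "ev \<phi> (f + g) = (\<Sum>a\<in>?A. Poly_Mapping.lookup (f + g) a * \<phi> a)"
    using keys_add[of f g] by (intro ev_superset) auto
  also have "\<dots> = (\<Sum>a\<in>?A. Poly_Mapping.lookup f a * \<phi> a) + (\<Sum>a\<in>?A. Poly_Mapping.lookup g a * \<phi> a)"
    by (simp add: lookup_add algebra_simps sum.distrib)
  also have "\<dots> = ev \<phi> f + ev \<phi> g"
    by (subst (1 2) ev_superset[of ?A]) auto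
  finally show ?thesis .
qed

lemma keys_pm_scale: "Poly_Mapping.keys (pm_scale c f) \<subseteq> Poly_Mapping.keys f"
  by (auto simp: in_keys_iff lookup_pm_scale)

lemma ev_scale: "ev \<phi> (pm_scale c f) = c * ev \<phi> f"
proof -
  have "ev \<phi> (pm_scale c f) = (\<Sum>a\<in>Poly_Mapping.keys f. Poly_Mapping.lookup (pm_scale c f) a * \<phi> a)"
    by (intro ev_superset keys_pm_scale) auto
  then show ?thesis
    by (simp add: ev_def lookup_pm_scale sum_distrib_left mult.assoc)
qed

lemma ev_single [simp]: "ev \<phi> (Poly_Mapping.single a c) = c * \<phi> a"
  by (auto simp: ev_def)

lemma pm_scale_single: "pm_scale c (Poly_Mapping.single a d) = Poly_Mapping.single a (c * d)"
  by (rule poly_mapping_eqI) (simp add: lookup_pm_scale lookup_single when_def)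

lemma pm_scale_m1: "pm_scale (- 1) f = - f"
  by (rule poly_mapping_eqI) (simp add: lookup_pm_scale)

lemma ev_uminus: "ev \<phi> (- f) = - ev \<phi> f"
  using ev_scale[of \<phi> "-1" f] by (simp add: pm_scale_m1)

lemma ev_diff: "ev \<phi> (f - g) = ev \<phi> f - ev \<phi> g"
  using ev_add[of \<phi> f "- g"] by (simp add: ev_uminus)

lemma ev_sum: "ev \<phi> (sum F A) = (\<Sum>x\<in>A. ev \<phi> (F x))"
  by (induction A rule: infinite_finite_induct) (auto simp: ev_add)

lemma ev_cong:
  assumes "\<And>a. a \<in> Poly_Mapping.keys f \<Longrightarrow> \<phi> a = \<psi> a"
  shows "ev \<phi> f = ev \<psi> f"
  unfolding ev_def using assms by (intro sum.cong) auto

lemma ev_fun_add: "ev (\<lambda>a. \<phi> a + \<psi> a) f = ev \<phi> f + ev \<psi> f"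
  by (simp add: ev_def algebra_simps sum.distrib)

lemma ev_fun_diff: "ev (\<lambda>a. \<phi> a - \<psi> a) f = ev \<phi> f - ev \<psi> f"
  by (simp add: ev_def algebra_simps sum_subtractf)

lemma ev_fun_mult: "ev (\<lambda>a. c * \<phi> a) f = c * ev \<phi> f"
  by (simp add: ev_def sum_distrib_left mult.left_commute)

lemma ev_fun_zero [simp]: "ev (\<lambda>a. 0) f = 0"
  by (simp add: ev_def)

lemma ev_commute: "ev (\<lambda>a. ev (\<lambda>b. F a b) g) f = ev (\<lambda>b. ev (\<lambda>a. F a b) f) g"
  unfolding ev_def by (simp add: sum_distrib_left mult.left_commute) (rule sum.swap)

lemma ev_lin_ext: "ev \<phi> (lin_ext F f) = ev (\<lambda>a. ev \<phi> (F a)) f"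
  by (simp add: lin_ext_def ev_sum ev_scale) (simp add: ev_def)

lemma sum_singles: "(\<Sum>a\<in>Poly_Mapping.keys f. Poly_Mapping.single a (Poly_Mapping.lookup f a)) = f"
  by (rule poly_mapping_eqI) (auto simp: lookup_sum lookup_single when_def in_keys_iff)

text \<open>Coefficients are values of indicator functionals. Identities between vectors can thus be
  checked by evaluation, where supports no longer matter.\<close>

lemma pm_eqI_ev:
  assumes "\<And>\<phi>. ev \<phi> f = ev \<phi> g"
  shows "f = (g :: 'a \<Rightarrow>\<^sub>0 'k::field)"
proof (rule poly_mapping_eqI)
  fix a
  have *: "ev (\<lambda>b. if b = a then 1 else 0) h = Poly_Mapping.lookup h a" for h :: "'a \<Rightarrow>\<^sub>0 'k"
    by (auto simp: ev_def if_distrib in_keys_iff cong: if_cong)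
  show "Poly_Mapping.lookup f a = Poly_Mapping.lookup g a"
    using assms[of "\<lambda>b. if b = a then 1 else 0"] by (simp add: *)
qed

lemma lin_ext_add: "lin_ext F (f + g) = lin_ext F f + lin_ext F g"
  by (rule pm_eqI_ev) (simp add: ev_lin_ext ev_add)

lemma lin_ext_scale: "lin_ext F (pm_scale c f) = pm_scale c (lin_ext F f)"
  by (rule pm_eqI_ev) (simp add: ev_lin_ext ev_scale)

lemma lin_ext_zero [simp]: "lin_ext F 0 = 0"
  by (simp add: lin_ext_def)

lemma lin_ext_single [simp]: "lin_ext F (Poly_Mapping.single a c) = pm_scale c (F a)"
  by (rule pm_eqI_ev) (simp add: ev_lin_ext ev_scale)

lemma keys_lin_ext: "Poly_Mapping.keys (lin_ext F f) \<subseteq> (\<Union>a\<in>Poly_Mapping.keys f. Poly_Mapping.keys (F a))"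
proof
  fix x assume "x \<in> Poly_Mapping.keys (lin_ext F f)"
  then have "(\<Sum>a\<in>Poly_Mapping.keys f. Poly_Mapping.lookup f a * Poly_Mapping.lookup (F a) x) \<noteq> 0"
    by (simp add: in_keys_iff lin_ext_def lookup_sum lookup_pm_scale)
  then obtain a where "a \<in> Poly_Mapping.keys f" "Poly_Mapping.lookup f a * Poly_Mapping.lookup (F a) x \<noteq> 0"
    by (rule sum.not_neutral_contains_not_neutral)
  then show "x \<in> (\<Union>a\<in>Poly_Mapping.keys f. Poly_Mapping.keys (F a))"
    by (auto simp: in_keys_iff)
qed

text \<open>Linearity is asked only for vectors supported in \<open>S\<close>, because the relations
  of a tensor power constrain only entries from the algebra; \<open>functional_eq_ml\<close> applies
  this to one entry of a tuple.\<close>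

lemma linear_eq_ev:
  assumes add: "\<And>f g. Poly_Mapping.keys f \<subseteq> S \<Longrightarrow> Poly_Mapping.keys g \<subseteq> S \<Longrightarrow> L (f + g) = L f + L g"
    and scale: "\<And>c f. Poly_Mapping.keys f \<subseteq> S \<Longrightarrow> L (pm_scale c f) = c * L f"
    and f: "Poly_Mapping.keys f \<subseteq> S"
  shows "L f = ev (\<lambda>a. L (Poly_Mapping.single a 1)) (f :: 'a \<Rightarrow>\<^sub>0 'k::field)"
proof -
  let ?s = "\<lambda>a. Poly_Mapping.single a (Poly_Mapping.lookup f a)"
  have L0: "L 0 = 0" using scale[of 0 0] by simp
  have "finite A \<Longrightarrow> A \<subseteq> S \<Longrightarrow> Poly_Mapping.keys (sum ?s A) \<subseteq> S \<and>
      L (sum ?s A) = (\<Sum>a\<in>A. Poly_Mapping.lookup f a * L (Poly_Mapping.single a 1))" for A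
  proof (induction A rule: finite_induct)
    case (insert a A)
    have eq: "?s a = pm_scale (Poly_Mapping.lookup f a) (Poly_Mapping.single a 1)"
      by (simp add: pm_scale_single)
    have ks: "Poly_Mapping.keys (Poly_Mapping.single a (1::'k)) \<subseteq> S" "Poly_Mapping.keys (?s a) \<subseteq> S"
      using insert.prems by auto
    have "Poly_Mapping.keys (?s a + sum ?s A) \<subseteq> S"
      using keys_add[of "?s a" "sum ?s A"] ks insert by blast
    moreover have "L (?s a) = Poly_Mapping.lookup f a * L (Poly_Mapping.single a 1)"
      unfolding eq by (rule scale[OF ks(1)])
    ultimately show ?case using insert ks add[of "?s a" "sum ?s A"] by simp
  qed (simp add: L0)
  from this[of "Poly_Mapping.keys f"] f show ?thesis
    by (simp add: sum_singles ev_def)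
qed

text \<open>A functional separating \<open>f\<close> from a subspace: extend \<open>f\<close> together with a basis of the
  subspace to a basis of the whole space.\<close>

lemma subspace_separation:
  fixes U :: "('a \<Rightarrow>\<^sub>0 'k::field) set"
  assumes U: "pm.subspace U" and f: "f \<notin> U"
  shows "\<exists>\<Phi>. (\<forall>u\<in>U. ev \<Phi> u = 0) \<and> ev \<Phi> f \<noteq> 0"
proof -
  interpret vp: vector_space_pair "pm_scale :: 'k \<Rightarrow> _ \<Rightarrow> ('a \<Rightarrow>\<^sub>0 'k)" "(*) :: 'k \<Rightarrow> 'k \<Rightarrow> 'k"
    by unfold_locales (auto simp: algebra_simps)
  obtain B where B: "B \<subseteq> U" "pm.independent B" "U \<subseteq> pm.span B"
    using pm.maximal_independent_subset[of U] by metis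
  have sp: "pm.span B = U"
    using B U by (metis pm.span_minimal subset_antisym)
  have ind: "pm.independent (insert f B)"
    using B f sp by (subst pm.independent_insert) auto
  obtain g where g: "Vector_Spaces.linear pm_scale (*) g" "\<forall>b\<in>insert f B. g b = (if b = f then 1 else 0)"
    using vp.linear_independent_extend[OF ind, of "\<lambda>b. if b = f then 1 else 0"] by blast
  have g': "g (x + y) = g x + g y" "g (pm_scale c x) = c * g x" for x y c
    using g(1) by (auto simp: Vector_Spaces.linear_iff)
  have geq: "g h = ev (\<lambda>a. g (Poly_Mapping.single a 1)) h" for h
    by (rule linear_eq_ev[of UNIV]) (auto simp: g')
  have fB: "f \<notin> B" using B f by auto
  have "g u = 0" if "u \<in> pm.span B" for u
    using that
  proof (induction rule: pm.span_induct_alt)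
    case base
    then show ?case using g'(2)[of 0 0] by simp
  next
    case (step c b y)
    then show ?case using g(2) fB by (auto simp: g')
  qed
  then have "(\<forall>u\<in>U. g u = 0)" "g f \<noteq> 0" using g(2) sp by auto
  then show ?thesis using geq by metis
qed

lemma subspace_free: "pm.subspace {f :: 'a \<Rightarrow>\<^sub>0 'k::field. Poly_Mapping.keys f \<subseteq> S}"
proof (rule pm.subspaceI)
  fix f g :: "'a \<Rightarrow>\<^sub>0 'k" and c :: 'k
  assume f: "f \<in> {f. Poly_Mapping.keys f \<subseteq> S}"
  then show "pm_scale c f \<in> {f. Poly_Mapping.keys f \<subseteq> S}"
    using keys_pm_scale[of c f] by blast
  assume "g \<in> {f. Poly_Mapping.keys f \<subseteq> S}"
  with f show "f + g \<in> {f. Poly_Mapping.keys f \<subseteq> S}"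
    using keys_add[of f g] by blast
qed simp

section \<open>Presentations of vector spaces\<close>

text \<open>Each of the nested quotients (tensor power, Connes space, homology) is presented by
  formal sums of tuples, so cosets of cosets reduce to subspaces of one free space.\<close>

definition presents :: "('a \<Rightarrow>\<^sub>0 'k::field) set \<Rightarrow> ('a \<Rightarrow>\<^sub>0 'k) set \<Rightarrow> (('a \<Rightarrow>\<^sub>0 'k) \<Rightarrow> 'v)
    \<Rightarrow> ('k, 'v, 'z) vspace_scheme \<Rightarrow> bool" where
  "presents Z K \<pi> V \<longleftrightarrow> pm.subspace Z \<and> pm.subspace K \<and> carrier V = \<pi> ` Z \<and> vzero V = \<pi> 0 \<and>
     (\<forall>a\<in>Z. \<forall>b\<in>Z. \<pi> a = \<pi> b \<longleftrightarrow> a - b \<in> K) \<and>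
     (\<forall>a\<in>Z. \<forall>b\<in>Z. vadd V (\<pi> a) (\<pi> b) = \<pi> (a + b)) \<and>
     (\<forall>c. \<forall>a\<in>Z. vscale V c (\<pi> a) = \<pi> (pm_scale c a))"

lemma presents_carrier: "presents Z K \<pi> V \<Longrightarrow> carrier V = \<pi> ` Z"
  and presents_zero: "presents Z K \<pi> V \<Longrightarrow> vzero V = \<pi> 0"
  and presents_eq_iff: "presents Z K \<pi> V \<Longrightarrow> a \<in> Z \<Longrightarrow> b \<in> Z \<Longrightarrow> \<pi> a = \<pi> b \<longleftrightarrow> a - b \<in> K"
  and presents_add: "presents Z K \<pi> V \<Longrightarrow> a \<in> Z \<Longrightarrow> b \<in> Z \<Longrightarrow> vadd V (\<pi> a) (\<pi> b) = \<pi> (a + b)"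
  and presents_scale: "presents Z K \<pi> V \<Longrightarrow> a \<in> Z \<Longrightarrow> vscale V c (\<pi> a) = \<pi> (pm_scale c a)"
  by (simp_all add: presents_def)

lemma presents_free: "presents {f. Poly_Mapping.keys f \<subseteq> S} {0} id (free_vspace S)"
  by (simp add: presents_def subspace_free free_vspace_def pm.subspace_0 pm.subspace_single_0)

lemma presents_vcoset:
  assumes p: "presents C K \<pi> V" and K': "K' \<subseteq> C" and a: "a \<in> C"
  shows "vcoset V (\<pi> ` K') (\<pi> a) = (\<lambda>k. \<pi> (a + k)) ` K'"
proof -
  have "vadd V (\<pi> a) (\<pi> k) = \<pi> (a + k)" if "k \<in> K'" for k
    using p K' a that by (auto simp: presents_def)
  then show ?thesis by (auto simp: vcoset_def image_image)
qed

lemma presents_vcoset_eq_iff: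
  assumes p: "presents C K \<pi> V" and K': "pm.subspace K'" "K' \<subseteq> C" "K \<subseteq> K'" and ab: "a \<in> C" "b \<in> C"
  shows "vcoset V (\<pi> ` K') (\<pi> a) = vcoset V (\<pi> ` K') (\<pi> b) \<longleftrightarrow> a - b \<in> K'"
proof
  assume eq: "vcoset V (\<pi> ` K') (\<pi> a) = vcoset V (\<pi> ` K') (\<pi> b)"
  have "\<pi> a \<in> (\<lambda>k. \<pi> (a + k)) ` K'"
    using pm.subspace_0[OF K'(1)] by (intro image_eqI[of _ _ 0]) auto
  then have "\<pi> a \<in> (\<lambda>k. \<pi> (b + k)) ` K'"
    using eq presents_vcoset[OF p K'(2)] ab by simp
  then obtain k where k: "k \<in> K'" "\<pi> a = \<pi> (b + k)" by auto
  have C: "pm.subspace C" using p by (simp add: presents_def)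
  have "b + k \<in> C" using k K' ab C by (auto intro: pm.subspace_add)
  then have "a - (b + k) \<in> K'" using p k K' ab by (auto simp: presents_def)
  then have "a - (b + k) + k \<in> K'" using k K' pm.subspace_add by blast
  then show "a - b \<in> K'" by simp
next
  have *: "(\<lambda>k. \<pi> (a + k)) ` K' \<subseteq> (\<lambda>k. \<pi> (b + k)) ` K'" if "a - b \<in> K'" for a b
  proof clarify
    fix k assume k: "k \<in> K'"
    show "\<pi> (a + k) \<in> (\<lambda>k. \<pi> (b + k)) ` K'"
      using pm.subspace_add[OF K'(1) that k] by (intro image_eqI[of _ _ "(a - b) + k"]) auto
  qed
  assume ab': "a - b \<in> K'"
  then have "b - a \<in> K'" using pm.subspace_neg[OF K'(1)] by fastforce
  with ab' * show "vcoset V (\<pi> ` K') (\<pi> a) = vcoset V (\<pi> ` K') (\<pi> b)"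
    unfolding presents_vcoset[OF p K'(2) ab(1)] presents_vcoset[OF p K'(2) ab(2)] by blast
qed

lemma presents_vquot:
  assumes p: "presents C K \<pi> V" and K': "pm.subspace K'" "K' \<subseteq> C" "K \<subseteq> K'"
    and Z: "pm.subspace Z" "Z \<subseteq> C"
  shows "presents Z K' (\<lambda>a. vcoset V (\<pi> ` K') (\<pi> a)) (vquot (V\<lparr>carrier := \<pi> ` Z\<rparr>) (\<pi> ` K'))"
proof -
  let ?q = "\<lambda>a. vcoset V (\<pi> ` K') (\<pi> a)"
  have C: "pm.subspace C" using p by (simp add: presents_def)
  have vc: "vcoset (V\<lparr>carrier := D\<rparr>) = vcoset V" for D
    by (auto simp: vcoset_def fun_eq_iff)
  have mem: "?q a = (\<lambda>k. \<pi> (a + k)) ` K'" if "a \<in> C" for a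
    by (rule presents_vcoset[OF p K'(2) that])
  have eq: "?q a = ?q b" if "a \<in> C" "b \<in> C" "a - b \<in> K'" for a b
    using presents_vcoset_eq_iff[OF p K' that(1,2)] that by simp
  have ne: "K' \<noteq> {}" using pm.subspace_0[OF K'(1)] by auto
  have add: "(\<Union>x\<in>?q a. \<Union>y\<in>?q b. vcoset V (\<pi> ` K') (vadd V x y)) = ?q (a + b)"
    if ab: "a \<in> C" "b \<in> C" for a b
  proof -
    have "vcoset V (\<pi> ` K') (vadd V (\<pi> (a + k)) (\<pi> (b + l))) = ?q (a + b)" if "k \<in> K'" "l \<in> K'" for k l
    proof -
      have C1: "a + k \<in> C" "b + l \<in> C" "a + k + (b + l) \<in> C" "a + b \<in> C"
        using ab that K' C by (auto intro!: pm.subspace_add[OF C])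
      then have "vadd V (\<pi> (a + k)) (\<pi> (b + l)) = \<pi> (a + k + (b + l))"
        using p by (auto simp: presents_def)
      moreover have "a + k + (b + l) - (a + b) \<in> K'"
        using pm.subspace_add[OF K'(1) that] by (simp add: algebra_simps)
      ultimately show ?thesis using eq C1 by simp
    qed
    then show ?thesis unfolding mem[OF ab(1)] mem[OF ab(2)] using ne by auto
  qed
  have sc: "(\<Union>x\<in>?q a. vcoset V (\<pi> ` K') (vscale V c x)) = ?q (pm_scale c a)" if a: "a \<in> C" for a c
  proof -
    have "vcoset V (\<pi> ` K') (vscale V c (\<pi> (a + k))) = ?q (pm_scale c a)" if "k \<in> K'" for k
    proof -
      have C1: "a + k \<in> C" "pm_scale c (a + k) \<in> C" "pm_scale c a \<in> C"
        using a that K' C by (auto intro!: pm.subspace_add[OF C] pm.subspace_scale[OF C])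
      then have "vscale V c (\<pi> (a + k)) = \<pi> (pm_scale c (a + k))"
        using p by (auto simp: presents_def)
      moreover have "pm_scale c (a + k) - pm_scale c a \<in> K'"
        using pm.subspace_scale[OF K'(1) that] by (simp add: pm.scale_right_distrib)
      ultimately show ?thesis using eq C1 by simp
    qed
    then show ?thesis unfolding mem[OF a] using ne by auto
  qed
  have 0: "\<pi> ` K' = ?q 0" using mem[of 0] pm.subspace_0[OF C] by simp
  show ?thesis
    unfolding presents_def vquot_def vc
  proof (intro conjI ballI allI)
    show "vzero \<lparr>carrier = vcoset V (\<pi> ` K') ` carrier (V\<lparr>carrier := \<pi> ` Z\<rparr>), vzero = \<pi> ` K',
       vadd = \<lambda>X Y. \<Union>x\<in>X. \<Union>y\<in>Y. vcoset V (\<pi> ` K') (vadd (V\<lparr>carrier := \<pi> ` Z\<rparr>) x y),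
       vscale = \<lambda>c X. \<Union>x\<in>X. vcoset V (\<pi> ` K') (vscale (V\<lparr>carrier := \<pi> ` Z\<rparr>) c x)\<rparr> = ?q 0"
      using 0 by simp
  next
    fix a b assume "a \<in> Z" "b \<in> Z"
    then show "?q a = ?q b \<longleftrightarrow> a - b \<in> K'"
      using presents_vcoset_eq_iff[OF p K'] Z by blast
  qed (use Z K' add sc in \<open>simp_all add: image_image subset_iff\<close>)
qed

lemma presents_vquot_UNIV:
  assumes p: "presents C K \<pi> V" and K': "pm.subspace K'" "K' \<subseteq> C" "K \<subseteq> K'"
  shows "presents C K' (\<lambda>a. vcoset V (\<pi> ` K') (\<pi> a)) (vquot V (\<pi> ` K'))"
proof -
  have "vcoset (V\<lparr>carrier := \<pi> ` C\<rparr>) = vcoset V"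
    by (auto simp: vcoset_def fun_eq_iff)
  then have "vquot (V\<lparr>carrier := \<pi> ` C\<rparr>) (\<pi> ` K') = vquot V (\<pi> ` K')"
    using p by (auto simp: presents_def vquot_def)
  moreover have "pm.subspace C" using p by (simp add: presents_def)
  ultimately show ?thesis using presents_vquot[OF p K', of C] by simp
qed

text \<open>\<open>induced\<close> is a union over a coset. As \<open>F\<close> is additive and maps
  \<open>K'\<close> into \<open>K1'\<close>, all members of the coset yield the same target coset,
  and the union collapses to it.\<close>

lemma presents_induced:
  assumes p: "presents C K \<pi> V" and K': "pm.subspace K'" "K' \<subseteq> C"
    and p1: "presents C1 K1 \<pi>1 V1" and K1': "pm.subspace K1'" "K1' \<subseteq> C1" "K1 \<subseteq> K1'"
    and f: "\<And>c. c \<in> C \<Longrightarrow> f (\<pi> c) = \<pi>1 (F c)"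
    and F: "F ` C \<subseteq> C1" "F ` K' \<subseteq> K1'" "\<And>a b. F (a + b) = F a + F b"
    and a: "a \<in> C"
  shows "induced V1 (\<pi>1 ` K1') f (vcoset V (\<pi> ` K') (\<pi> a)) = vcoset V1 (\<pi>1 ` K1') (\<pi>1 (F a))"
proof -
  have C: "pm.subspace C" using p by (simp add: presents_def)
  have "vcoset V1 (\<pi>1 ` K1') (f (\<pi> (a + k))) = vcoset V1 (\<pi>1 ` K1') (\<pi>1 (F a))" if "k \<in> K'" for k
  proof -
    have "a + k \<in> C" using a that K' by (auto intro!: pm.subspace_add[OF C])
    moreover have "F (a + k) - F a \<in> K1'" using F that by auto
    ultimately show ?thesis
      using f presents_vcoset_eq_iff[OF p1 K1', of "F (a + k)" "F a"] F(1) a by auto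
  qed
  then show ?thesis
    unfolding induced_def presents_vcoset[OF p K'(2) a] using pm.subspace_0[OF K'(1)] by auto
qed

text \<open>The inclusion of \<open>Z2\<close> in \<open>Z1\<close> induces a map from
  \<open>V2\<close> to \<open>V1\<close>; \<open>K\<close> makes it well defined and injective,
  \<open>split\<close> makes it onto. The map \<open>g\<close> below is its inverse, with
  \<open>r\<close> choosing representatives in \<open>Z2\<close>.\<close>

lemma presents_iso:
  assumes p1: "presents Z1 K1 \<pi>1 V1" and p2: "presents Z2 K2 \<pi>2 V2"
    and Z: "Z2 \<subseteq> Z1" and K: "\<And>a. a \<in> Z2 \<Longrightarrow> a \<in> K1 \<longleftrightarrow> a \<in> K2"
    and split: "\<And>a. a \<in> Z1 \<Longrightarrow> \<exists>b\<in>Z2. a - b \<in> K1"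
  shows "V1 \<cong>\<^sub>v V2"
proof -
  define r where "r = (\<lambda>a. SOME b. b \<in> Z2 \<and> a - b \<in> K1)"
  have r: "r a \<in> Z2" "a - r a \<in> K1" if "a \<in> Z1" for a
    using someI_ex[of "\<lambda>b. b \<in> Z2 \<and> a - b \<in> K1"] split[OF that] unfolding r_def by auto
  have s: "pm.subspace Z1" "pm.subspace K1" "pm.subspace Z2" "pm.subspace K2"
    using p1 p2 by (auto simp: presents_def)
  have e1: "\<pi>1 a = \<pi>1 b \<longleftrightarrow> a - b \<in> K1" if "a \<in> Z1" "b \<in> Z1" for a b
    using p1 that by (auto simp: presents_def)
  have e2: "\<pi>2 a = \<pi>2 b \<longleftrightarrow> a - b \<in> K2" if "a \<in> Z2" "b \<in> Z2" for a b
    using p2 that by (auto simp: presents_def)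
  have e12: "\<pi>2 a = \<pi>2 b \<longleftrightarrow> \<pi>1 a = \<pi>1 b" if "a \<in> Z2" "b \<in> Z2" for a b
    using e1[of a b] e2[OF that] K[of "a - b"] Z that pm.subspace_diff[OF s(3) that] by auto
  have r1: "\<pi>1 (r a) = \<pi>1 a" if "a \<in> Z1" for a
    using r[OF that] e1[of a "r a"] Z that by auto
  define g where "g = (\<lambda>v. \<pi>2 (r (SOME a. a \<in> Z1 \<and> \<pi>1 a = v)))"
  have g: "g (\<pi>1 a) = \<pi>2 a" if "a \<in> Z2" for a
  proof -
    let ?b = "SOME b. b \<in> Z1 \<and> \<pi>1 b = \<pi>1 a"
    have "?b \<in> Z1 \<and> \<pi>1 ?b = \<pi>1 a" 
      by (rule someI[of _ a]) (use that Z in auto)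
    then have "\<pi>1 (r ?b) = \<pi>1 a" "r ?b \<in> Z2" using r1 r by auto
    then show ?thesis using e12 that unfolding g_def by auto
  qed
  have c1: "carrier V1 = \<pi>1 ` Z2"
  proof -
    have "\<pi>1 a \<in> \<pi>1 ` Z2" if "a \<in> Z1" for a
      using r1[OF that] r[OF that] by (metis image_eqI)
    then show ?thesis using p1 Z by (auto simp: presents_def)
  qed
  have "bij_betw g (carrier V1) (carrier V2)"
    unfolding bij_betw_def inj_on_def c1
    using p2 g e12 by (auto simp: presents_def image_image)
  moreover have "g (vadd V1 (\<pi>1 a) (\<pi>1 b)) = vadd V2 (g (\<pi>1 a)) (g (\<pi>1 b))" if "a \<in> Z2" "b \<in> Z2" for a b
    using p1 p2 that Z g pm.subspace_add[OF s(3) that] by (auto simp: presents_def subset_iff)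
  moreover have "g (vscale V1 c (\<pi>1 a)) = vscale V2 c (g (\<pi>1 a))" if "a \<in> Z2" for a c
    using p1 p2 that Z g pm.subspace_scale[OF s(3) that] by (auto simp: presents_def subset_iff)
  ultimately show ?thesis unfolding vspace_iso_def c1 by (intro exI[of _ g]) auto
qed

section \<open>Cochains on words\<close>

text \<open>A basis whose products are basis elements or zero is encoded by a predicate \<open>p\<close>, telling
  which products are nonzero, and their values \<open>m\<close>. A cochain is a scalar function on words.\<close>

fun bar :: "('a \<Rightarrow> 'a \<Rightarrow> bool) \<Rightarrow> ('a \<Rightarrow> 'a \<Rightarrow> 'a) \<Rightarrow> ('a list \<Rightarrow> 'k::field) \<Rightarrow> 'a list \<Rightarrow> 'k" where
  "bar p m \<phi> (a # b # w) = (if p a b then \<phi> (m a b # w) else 0) - bar p m (\<lambda>u. \<phi> (a # u)) (b # w)"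
| "bar p m \<phi> [a] = 0"
| "bar p m \<phi> [] = 0"

definition wrap :: "('a \<Rightarrow> 'a \<Rightarrow> bool) \<Rightarrow> ('a \<Rightarrow> 'a \<Rightarrow> 'a) \<Rightarrow> ('a list \<Rightarrow> 'k::field) \<Rightarrow> 'a list \<Rightarrow> 'k" where
  "wrap p m \<phi> w = (if p (last w) (hd w) then \<phi> (m (last w) (hd w) # tl (butlast w)) else 0)"

text \<open>The transpose of the Hochschild boundary. A one-letter word has no faces, whereas
  \<open>wrap\<close> would multiply its letter with itself; hence the case distinction.\<close>

definition hb :: "('a \<Rightarrow> 'a \<Rightarrow> bool) \<Rightarrow> ('a \<Rightarrow> 'a \<Rightarrow> 'a) \<Rightarrow> ('a list \<Rightarrow> 'k::field) \<Rightarrow> 'a list \<Rightarrow> 'k" where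
  "hb p m \<phi> w =
    (if length w < 2 then 0 else bar p m \<phi> w + (- 1) ^ (length w - 1) * wrap p m \<phi> w)"

text \<open>Vanishing on the image of 1 - \<tau>, in transposed form.\<close>

definition cyclic_cochain :: "'a set \<Rightarrow> nat \<Rightarrow> ('a list \<Rightarrow> 'k::field) \<Rightarrow> bool" where
  "cyclic_cochain S n \<phi> \<longleftrightarrow>
    (\<forall>z u. length u = n \<longrightarrow> set (z # u) \<subseteq> S \<longrightarrow> \<phi> (z # u) = (- 1) ^ n * \<phi> (u @ [z]))"

definition words :: "'a set \<Rightarrow> nat \<Rightarrow> 'a list set" where
  "words S n = {w. length w = Suc n \<and> set w \<subseteq> S}"

lemma cyclic_cochainD:
  "cyclic_cochain S n \<phi> \<Longrightarrow> length u = n \<Longrightarrow> z \<in> S \<Longrightarrow> set u \<subseteq> S \<Longrightarrow> \<phi> (z # u) = (- 1) ^ n * \<phi> (u @ [z])"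
  by (auto simp: cyclic_cochain_def)

lemma long_list_cases:
  assumes "2 \<le> length w"
  obtains a u z where "w = a # u @ [z]"
  using assms by (cases w; cases "tl w" rule: rev_cases) auto

lemma wrap_append [simp]: "wrap p m \<phi> (a # u @ [z]) = (if p z a then \<phi> (m z a # u) else 0)"
  by (simp add: wrap_def butlast_append)

lemma bar_cong:
  assumes "\<And>u. length u + 1 = length w \<Longrightarrow> set u \<subseteq> S \<Longrightarrow> \<phi> u = \<psi> u" "set w \<subseteq> S"
    "\<And>a b. a \<in> S \<Longrightarrow> b \<in> S \<Longrightarrow> p a b = p' a b"
    "\<And>a b. a \<in> S \<Longrightarrow> b \<in> S \<Longrightarrow> p a b \<Longrightarrow> m a b = m' a b"
    "\<And>a b. a \<in> S \<Longrightarrow> b \<in> S \<Longrightarrow> p a b \<Longrightarrow> m a b \<in> S"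
  shows "bar p m \<phi> w = bar p' m' \<psi> w"
  using assms
proof (induction p m \<phi> w arbitrary: \<psi> rule: bar.induct)
  case (1 p m \<phi> a b w)
  have S: "a \<in> S" "b \<in> S" "set w \<subseteq> S" using "1.prems"(2) by auto
  have "bar p m (\<lambda>u. \<phi> (a # u)) (b # w) = bar p' m' (\<lambda>u. \<psi> (a # u)) (b # w)"
    using S by (intro "1.IH" "1.prems") auto
  moreover have "\<phi> (m a b # w) = \<psi> (m a b # w)" if "p a b"
    using S that "1.prems"(5) by (intro "1.prems"(1)) auto
  ultimately show ?case
    using "1.prems"(3)[OF S(1,2)] "1.prems"(4)[OF S(1,2)] by auto
qed auto

lemma hb_cong:
  assumes "\<And>u. length u + 1 = length w \<Longrightarrow> set u \<subseteq> S \<Longrightarrow> \<phi> u = \<psi> u" "set w \<subseteq> S"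
    "\<And>a b. a \<in> S \<Longrightarrow> b \<in> S \<Longrightarrow> p a b = p' a b"
    "\<And>a b. a \<in> S \<Longrightarrow> b \<in> S \<Longrightarrow> p a b \<Longrightarrow> m a b = m' a b"
    "\<And>a b. a \<in> S \<Longrightarrow> b \<in> S \<Longrightarrow> p a b \<Longrightarrow> m a b \<in> S"
  shows "hb p m \<phi> w = hb p' m' \<psi> w"
proof (cases "2 \<le> length w")
  case True
  then obtain a u z where w: "w = a # u @ [z]" by (rule long_list_cases)
  have S: "a \<in> S" "z \<in> S" "set u \<subseteq> S" using assms(2) w by auto
  have "\<phi> (m z a # u) = \<psi> (m z a # u)" if "p z a"
    using S that assms(5) w by (intro assms(1)) auto
  then have "wrap p m \<phi> w = wrap p' m' \<psi> w"
    using assms(3)[OF S(2,1)] assms(4)[OF S(2,1)] w by auto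
  with bar_cong[OF assms] show ?thesis by (simp add: hb_def)
qed (simp add: hb_def)

lemma bar_add: "bar p m (\<lambda>u. \<phi> u + \<psi> u) w = bar p m \<phi> w + bar p m \<psi> w"
  by (induction p m \<phi> w arbitrary: \<psi> rule: bar.induct) auto

lemma bar_diff: "bar p m (\<lambda>u. \<phi> u - \<psi> u) w = bar p m \<phi> w - bar p m \<psi> w"
  by (induction p m \<phi> w arbitrary: \<psi> rule: bar.induct) auto

lemma bar_mult: "bar p m (\<lambda>u. c * \<phi> u) w = c * bar p m \<phi> w"
  by (induction p m \<phi> w rule: bar.induct) (auto simp: algebra_simps)

lemma bar_zero [simp]: "bar p m (\<lambda>u. 0) w = 0"
  using bar_mult[of p m 0 "\<lambda>u. 0" w] by simp

lemma hb_diff: "hb p m (\<lambda>u. \<phi> u - \<psi> u) w = hb p m \<phi> w - hb p m \<psi> w"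
  by (auto simp: hb_def bar_diff wrap_def algebra_simps)

lemma hb_mult: "hb p m (\<lambda>u. c * \<phi> u) w = c * hb p m \<phi> w"
  by (auto simp: hb_def bar_mult wrap_def algebra_simps)

lemma bar_snoc:
  assumes "w \<noteq> []"
  shows "bar p m \<phi> (w @ [z]) = bar p m (\<lambda>u. \<phi> (u @ [z])) w
    + (- 1) ^ (length w - 1) * (if p (last w) z then \<phi> (butlast w @ [m (last w) z]) else 0)"
  using assms
proof (induction p m \<phi> w rule: bar.induct)
  case (1 p m \<phi> a b w)
  then show ?case by (simp add: algebra_simps)
qed auto

text \<open>Rotation permutes the faces: the first inner face of \<open>z # v\<close> becomes the
  wrapping face of \<open>v @ [z]\<close>, the wrapping face of \<open>z # v\<close> becomes the
  last inner face of \<open>v @ [z]\<close>, and the other faces are rotated by the cyclicity of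
  \<open>\<phi>\<close>.\<close>

lemma cyclic_cochain_hb:
  assumes \<phi>: "cyclic_cochain S n \<phi>"
    and S: "\<And>a b. a \<in> S \<Longrightarrow> b \<in> S \<Longrightarrow> p a b \<Longrightarrow> m a b \<in> S"
  shows "cyclic_cochain S (Suc n) (hb p m \<phi>)"
  unfolding cyclic_cochain_def
proof (intro allI impI)
  fix z v assume v: "length v = Suc n" "set (z # v) \<subseteq> S"
  then obtain a u where au: "v = a # u" by (cases v) auto
  have lu: "length u = n" "set u \<subseteq> S" "z \<in> S" "a \<in> S" using v au by auto
  have za: "hb p m \<phi> (v @ [z]) = bar p m (\<lambda>u. \<phi> (u @ [z])) v
      + (- 1) ^ n * (if p (last v) z then \<phi> (butlast v @ [m (last v) z]) else 0)
      - (- 1) ^ n * (if p z a then \<phi> (m z a # u) else 0)"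
  proof -
    have "wrap p m \<phi> (v @ [z]) = (if p z a then \<phi> (m z a # u) else 0)"
      using au by simp
    then show ?thesis
      using lu au by (simp only: hb_def) (simp add: bar_snoc del: append_Cons)
  qed
  have w: "wrap p m \<phi> (z # v) = (- 1) ^ n * (if p (last v) z then \<phi> (butlast v @ [m (last v) z]) else 0)"
  proof -
    have "last v \<in> set v" "v \<noteq> []" using au by auto
    moreover have "set (butlast v) \<subseteq> S" using v by (auto dest: in_set_butlastD)
    ultimately show ?thesis
      using cyclic_cochainD[OF \<phi>, of "butlast v" "m (last v) z"] v S[of "last v" z] lu
      by (auto simp: wrap_def subset_iff)
  qed
  have b: "bar p m (\<lambda>u. \<phi> (z # u)) v = (- 1) ^ n * bar p m (\<lambda>u. \<phi> (u @ [z])) v"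
  proof -
    have "bar p m (\<lambda>u. \<phi> (z # u)) v = bar p m (\<lambda>u. (- 1) ^ n * \<phi> (u @ [z])) v"
      using v S by (intro bar_cong[of _ S] cyclic_cochainD[OF \<phi>]) auto
    then show ?thesis by (simp add: bar_mult)
  qed
  have s: "(- 1) ^ n * (- 1) ^ n = (1::'b)" by (simp flip: power_mult_distrib)
  have "hb p m \<phi> (z # v) = (if p z a then \<phi> (m z a # u) else 0) - (- 1) ^ n * bar p m (\<lambda>u. \<phi> (u @ [z])) v
      - (- 1) ^ n * wrap p m \<phi> (z # v)"
    using b au lu by (simp add: hb_def)
  also have "\<dots> = (- 1) ^ Suc n * hb p m \<phi> (v @ [z])"
    unfolding za w using s by (simp add: algebra_simps)
  finally show "hb p m \<phi> (z # v) = (- 1) ^ Suc n * hb p m \<phi> (v @ [z])" .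
qed

section \<open>The letter algebra\<close>

text \<open>Letters \<open>(v, l)\<close> multiply by \<open>(v, l) (v', l') = \<epsilon> v' (v, l l')\<close>; then \<open>(\<star>, 1)\<close> is a right unit.
  Cyclic words in a connected groupoid are cyclic words in letters whose first components
  record the junctions between consecutive arrows.\<close>

locale letters =
  fixes eps :: "'v \<Rightarrow> bool" and star :: 'v and V :: "'v set"
    and m :: "'l \<Rightarrow> 'l \<Rightarrow> 'l" and e :: 'l and G :: "'l set"
  assumes star: "star \<in> V" "eps star" and e: "e \<in> G"
    and m_closed: "a \<in> G \<Longrightarrow> b \<in> G \<Longrightarrow> m a b \<in> G"
    and m_left: "a \<in> G \<Longrightarrow> m e a = a" and m_right: "a \<in> G \<Longrightarrow> m a e = a"
begin

definition lp :: "'v \<times> 'l \<Rightarrow> 'v \<times> 'l \<Rightarrow> bool" where "lp a b = eps (fst b)"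
definition lm :: "'v \<times> 'l \<Rightarrow> 'v \<times> 'l \<Rightarrow> 'v \<times> 'l" where "lm a b = (fst a, m (snd a) (snd b))"

lemma lp_simp [simp]: "lp a (v, l) = eps v" by (simp add: lp_def)
lemma lm_simp [simp]: "lm (v, l) (v', l') = (v, m l l')" by (simp add: lm_def)

text \<open>Transposed action on words of the derivation P(v, l) = (v, l) - \<open>eps v\<close>
  (\<open>star\<close>, l), applied to one letter at a time.\<close>

fun Num :: "(('v \<times> 'l) list \<Rightarrow> 'k::field) \<Rightarrow> ('v \<times> 'l) list \<Rightarrow> 'k" where
  "Num \<phi> [] = 0"
| "Num \<phi> ((v, l) # w) = \<phi> ((v, l) # w) - (if eps v then \<phi> ((star, l) # w) else 0)
     + Num (\<lambda>u. \<phi> ((v, l) # u)) w"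

text \<open>At each position the letter (v, l) is split into P(v, \<open>e\<close>) and
  (\<open>star\<close>, l), whose product is P(v, l); the sign alternates with the position.\<close>

fun H :: "(('v \<times> 'l) list \<Rightarrow> 'k::field) \<Rightarrow> ('v \<times> 'l) list \<Rightarrow> 'k" where
  "H \<phi> [] = 0"
| "H \<phi> ((v, l) # w) = \<phi> ((v, e) # (star, l) # w) - (if eps v then \<phi> ((star, e) # (star, l) # w) else 0)
     - H (\<lambda>u. \<phi> ((v, l) # u)) w"

text \<open>Pullback of cochains along (v, l) \<mapsto> \<open>eps v\<close> l. This map to the
  group algebra is multiplicative, which is why \<open>tr\<close> commutes with
  \<open>hb\<close>.\<close>

definition tr :: "('l list \<Rightarrow> 'k::field) \<Rightarrow> ('v \<times> 'l) list \<Rightarrow> 'k" where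
  "tr \<phi> w = (if \<forall>a\<in>set w. eps (fst a) then \<phi> (map snd w) else 0)"

section \<open>Linearity and locality of the operators on words\<close>

lemma Num_add: "Num (\<lambda>u. \<phi> u + \<psi> u) w = Num \<phi> w + Num \<psi> w"
  by (induction \<phi> w arbitrary: \<psi> rule: Num.induct) auto
lemma Num_diff: "Num (\<lambda>u. \<phi> u - \<psi> u) w = Num \<phi> w - Num \<psi> w"
  by (induction \<phi> w arbitrary: \<psi> rule: Num.induct) auto
lemma Num_mult: "Num (\<lambda>u. c * \<phi> u) w = c * Num \<phi> w"
  by (induction \<phi> w rule: Num.induct) (auto simp: algebra_simps)
lemma Num_zero [simp]: "Num (\<lambda>u. 0) w = 0"
  using Num_mult[of 0 "\<lambda>u. 0" w] by simp
lemma Num_uminus: "Num (\<lambda>u. - \<phi> u) w = - Num \<phi> w"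
  using Num_mult[of "- 1" \<phi> w] by simp

lemma H_add: "H (\<lambda>u. \<phi> u + \<psi> u) w = H \<phi> w + H \<psi> w"
  by (induction \<phi> w arbitrary: \<psi> rule: H.induct) auto
lemma H_diff: "H (\<lambda>u. \<phi> u - \<psi> u) w = H \<phi> w - H \<psi> w"
  by (induction \<phi> w arbitrary: \<psi> rule: H.induct) auto
lemma H_mult: "H (\<lambda>u. c * \<phi> u) w = c * H \<phi> w"
  by (induction \<phi> w rule: H.induct) (auto simp: algebra_simps)
lemma H_zero [simp]: "H (\<lambda>u. 0) w = 0"
  using H_mult[of 0 "\<lambda>u. 0" w] by simp
lemma H_uminus: "H (\<lambda>u. - \<phi> u) w = - H \<phi> w"
  using H_mult[of "- 1" \<phi> w] by simp

lemma Num_cong: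
  assumes "\<And>u. length u = length w \<Longrightarrow> set u \<subseteq> V \<times> G \<Longrightarrow> \<phi> u = \<psi> u" "set w \<subseteq> V \<times> G"
  shows "Num \<phi> w = Num \<psi> w"
  using assms
proof (induction \<phi> w arbitrary: \<psi> rule: Num.induct)
  case (2 \<phi> v l w)
  have "Num (\<lambda>u. \<phi> ((v, l) # u)) w = Num (\<lambda>u. \<psi> ((v, l) # u)) w"
    using "2.prems" by (intro "2.IH") auto
  moreover have "\<phi> ((v, l) # w) = \<psi> ((v, l) # w)" "\<phi> ((star, l) # w) = \<psi> ((star, l) # w)"
    using "2.prems" star by auto
  ultimately show ?case by simp
qed auto

lemma H_cong:
  assumes "\<And>u. length u = Suc (length w) \<Longrightarrow> set u \<subseteq> V \<times> G \<Longrightarrow> \<phi> u = \<psi> u" "set w \<subseteq> V \<times> G"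
  shows "H \<phi> w = H \<psi> w"
  using assms
proof (induction \<phi> w arbitrary: \<psi> rule: H.induct)
  case (2 \<phi> v l w)
  have "H (\<lambda>u. \<phi> ((v, l) # u)) w = H (\<lambda>u. \<psi> ((v, l) # u)) w"
    using "2.prems" by (intro "2.IH") auto
  moreover have "\<phi> ((v, e) # (star, l) # w) = \<psi> ((v, e) # (star, l) # w)"
    "\<phi> ((star, e) # (star, l) # w) = \<psi> ((star, e) # (star, l) # w)"
    using "2.prems" star e by auto
  ultimately show ?case by simp
qed auto

section \<open>Interaction of the derivation and the homotopy with faces and rotations\<close>

lemma Num_snoc: "Num \<phi> (w @ [(v, l)]) = Num (\<lambda>u. \<phi> (u @ [(v, l)])) w
    + \<phi> (w @ [(v, l)]) - (if eps v then \<phi> (w @ [(star, l)]) else 0)"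
  by (induction \<phi> w rule: Num.induct) auto

lemma H_snoc: "H \<phi> (w @ [(v, l)]) = H (\<lambda>u. \<phi> (u @ [(v, l)])) w
    + (- 1) ^ length w * (\<phi> (w @ [(v, e), (star, l)]) - (if eps v then \<phi> (w @ [(star, e), (star, l)]) else 0))"
  by (induction \<phi> w rule: H.induct) (auto simp: algebra_simps)

text \<open>P is a derivation: P(a b) = P(a) b, while a P(b) = 0 because \<open>eps\<close> vanishes
  on P(b).\<close>

lemma bar_Num: "bar lp lm (Num \<phi>) w = Num (bar lp lm \<phi>) w"
proof (induction lp lm \<phi> w rule: bar.induct)
  case (1 \<phi> a b w)
  obtain v l where a: "a = (v, l)" by force
  obtain v' l' where b: "b = (v', l')" by force
  show ?case
    using 1 unfolding a b
    by (cases "eps v"; cases "eps v'") (simp_all add: bar_diff bar_add Num_diff Num_uminus star)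
next
  case (2 \<phi> a)
  then show ?case by (cases a) simp
qed simp

text \<open>For a split letter, multiplying the two halves gives the term of \<open>Num\<close>.
  Multiplying the first half by the preceding letter gives zero. Multiplying the second half by the
  following letter cancels against splitting after that product has been formed.\<close>

lemma bar_H:
  assumes "set w \<subseteq> V \<times> G"
  shows "bar lp lm (H \<phi>) w + H (bar lp lm \<phi>) w = Num \<phi> w"
  using assms
proof (induction lp lm \<phi> w rule: bar.induct)
  case (1 \<phi> a b w)
  obtain v l where a: "a = (v, l)" by force
  obtain v' l' where b: "b = (v', l')" by force
  have l: "m e l = l" "m l e = l" "m e l' = l'" "m l' e = l'" "m e (m l l') = m l l'"
    using 1 a b m_left m_right m_closed by auto
  show ?case
    using 1 unfolding a b
    by (cases "eps v"; cases "eps v'") (simp_all add: bar_diff bar_add H_diff H_uminus star l algebra_simps)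
next
  case (2 \<phi> a)
  then show ?case using m_left m_right e by (cases a) (auto simp: star)
qed simp

lemma wrap_Num:
  "wrap lp lm (Num \<phi>) (a # u @ [z]) = Num (wrap lp lm \<phi>) (a # u @ [z])"
proof -
  obtain v l where a: "a = (v, l)" by force
  obtain v' l' where z: "z = (v', l')" by force
  show ?thesis
    unfolding a z by (cases "eps v"; cases "eps v'") (simp_all add: Num_snoc star)
qed

lemma hb_Num:
  assumes "set w \<subseteq> V \<times> G"
  shows "hb lp lm (Num \<phi>) w = Num (hb lp lm \<phi>) w"
proof (cases "2 \<le> length w")
  case True
  then obtain a u z where w: "w = a # u @ [z]" by (rule long_list_cases)
  let ?s = "(- 1) ^ (length w - 1)"
  \<comment> \<open>\<open>Num\<close> evaluates its argument only at words as long as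
    \<open>w\<close>, so the sign in \<open>hb\<close> is constant.\<close>
  have "Num (hb lp lm \<phi>) w = Num (\<lambda>x. bar lp lm \<phi> x + ?s * wrap lp lm \<phi> x) w"
    using True assms by (intro Num_cong) (auto simp: hb_def)
  also have "\<dots> = bar lp lm (Num \<phi>) w + ?s * wrap lp lm (Num \<phi>) w"
    unfolding Num_add Num_mult bar_Num w wrap_Num ..
  finally show ?thesis using True by (simp add: hb_def)
next
  case False
  have "Num (hb lp lm \<phi>) w = Num (\<lambda>x. 0) w"
    using False assms by (intro Num_cong) (auto simp: hb_def)
  then show ?thesis using False by (simp add: hb_def)
qed

text \<open>When the last letter is split, its second half is multiplied into the first letter while
  its first half stays at the end. Cyclicity of \<open>\<phi>\<close> rotates that half to the
  front, which gives the splitting of the wrapped product. Splitting the first letter contributes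
  nothing, since z P(v, \<open>e\<close>) = 0.\<close>

lemma wrap_H:
  assumes \<phi>: "cyclic_cochain (V \<times> G) (Suc (length u)) \<phi>" and S: "set (a # u @ [z]) \<subseteq> V \<times> G"
  shows "wrap lp lm (H \<phi>) (a # u @ [z]) = H (wrap lp lm \<phi>) (a # u @ [z])"
proof -
  obtain v l where a: "a = (v, l)" by force
  obtain v' l' where z: "z = (v', l')" by force
  have G: "l \<in> G" "l' \<in> G" "v \<in> V" "v' \<in> V" "set u \<subseteq> V \<times> G" using S a z by auto
  have m1: "m l' e = l'" "m e (m l' l) = m l' l" using m_left m_right m_closed G by auto
  have c: "\<phi> ((y, e) # (star, m l' l) # u) = - ((- 1) ^ length u * \<phi> ((star, m l' l) # u @ [(y, e)]))"
    if "y \<in> V" for y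
    using cyclic_cochainD[OF \<phi>, of "(star, m l' l) # u" "(y, e)"] that G star e m_closed by auto
  have w2: "wrap lp lm \<phi> (x # y # u' @ [t]) = (if lp t x then \<phi> (lm t x # y # u') else 0)" for x y t u'
    using wrap_append[of lp lm \<phi> x "y # u'" t] by simp
  have w3: "wrap lp lm \<phi> (x # u' @ [y, t]) = (if lp t x then \<phi> (lm t x # u' @ [y]) else 0)" for x y t u'
    using wrap_append[of lp lm \<phi> x "u' @ [y]" t] by simp
  show ?thesis
    unfolding a z
    using c[of v'] c[of star] G m1
    by (cases "eps v"; cases "eps v'") (simp_all add: H_snoc w2 w3 star algebra_simps)
qed

lemma hb_H:
  assumes \<phi>: "cyclic_cochain (V \<times> G) n \<phi>" and w: "w \<in> words (V \<times> G) n"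
  shows "hb lp lm (H \<phi>) w + H (hb lp lm \<phi>) w = Num \<phi> w"
proof (cases n)
  case 0
  then obtain v l where w': "w = [(v, l)]" "l \<in> G"
    using w by (auto simp: words_def length_Suc_conv)
  then show ?thesis
    using m_left m_right e by (auto simp: hb_def star wrap_def)
next
  case (Suc k)
  have lw: "length w = Suc (Suc k)" "set w \<subseteq> V \<times> G" using w Suc by (auto simp: words_def)
  obtain a u z where w': "w = a # u @ [z]" by (rule long_list_cases[of w]) (use lw in auto)
  \<comment> \<open>\<open>H\<close> evaluates at words one letter longer than \<open>w\<close>, so
    this wrapping sign is opposite to the one in \<open>hb lp lm (H \<phi>) w\<close>; by
    \<open>wrap_H\<close> the two wrapping terms cancel and \<open>bar_H\<close> remains.\<close>
  have "H (hb lp lm \<phi>) w = H (\<lambda>x. bar lp lm \<phi> x + (- 1) ^ length w * wrap lp lm \<phi> x) w"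
    using lw by (intro H_cong) (auto simp: hb_def)
  also have "\<dots> = H (bar lp lm \<phi>) w + (- 1) ^ length w * wrap lp lm (H \<phi>) w"
    using wrap_H[of u \<phi> a z] \<phi> Suc lw w' unfolding H_add H_mult by simp
  finally show ?thesis
    using bar_H[OF lw(2), of \<phi>] lw by (simp add: hb_def)
qed

lemma cyclic_cochain_Num:
  assumes \<phi>: "cyclic_cochain (V \<times> G) n \<phi>"
  shows "cyclic_cochain (V \<times> G) n (Num \<phi>)"
  unfolding cyclic_cochain_def
proof (intro allI impI)
  fix z u assume u: "length u = n" "set (z # u) \<subseteq> V \<times> G"
  obtain v l where z: "z = (v, l)" by force
  have "Num (\<lambda>x. \<phi> ((v, l) # x)) u = Num (\<lambda>x. (- 1) ^ n * \<phi> (x @ [(v, l)])) u"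
    using u z by (intro Num_cong cyclic_cochainD[OF \<phi>]) auto
  then show "Num \<phi> (z # u) = (- 1) ^ n * Num \<phi> (u @ [z])"
    using cyclic_cochainD[OF \<phi>, of u "(v, l)"] cyclic_cochainD[OF \<phi>, of u "(star, l)"] u star
    unfolding z by (auto simp: Num_snoc Num_mult algebra_simps)
qed

text \<open>If \<open>z\<close> is not split, one rotation in degree \<open>n + 1\<close> and the
  sign of the shifted position combine to (-1)^n. If \<open>z\<close> is split, its two halves need
  two rotations, whose signs cancel, and (-1)^n is the sign of the last position.\<close>

lemma cyclic_cochain_H:
  assumes \<phi>: "cyclic_cochain (V \<times> G) (Suc n) \<phi>"
  shows "cyclic_cochain (V \<times> G) n (H \<phi>)"
  unfolding cyclic_cochain_def
proof (intro allI impI)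
  fix z u assume u: "length u = n" "set (z # u) \<subseteq> V \<times> G"
  obtain v l where z: "z = (v, l)" by force
  have G: "v \<in> V" "l \<in> G" "set u \<subseteq> V \<times> G" using u z by auto
  have s: "(- 1) ^ n * (- 1) ^ n = (1::'a)" by (simp flip: power_mult_distrib)
  have "H (\<lambda>x. \<phi> ((v, l) # x)) u = H (\<lambda>x. - ((- 1) ^ n) * \<phi> (x @ [(v, l)])) u"
  proof (rule H_cong)
    fix x assume "length x = Suc (length u)" "set x \<subseteq> V \<times> G"
    then show "\<phi> ((v, l) # x) = - ((- 1) ^ n) * \<phi> (x @ [(v, l)])"
      using cyclic_cochainD[OF \<phi>, of x "(v, l)"] u G by simp
  qed (rule G(3))
  then have h: "H (\<lambda>x. \<phi> ((v, l) # x)) u = - ((- 1) ^ n) * H (\<lambda>x. \<phi> (x @ [(v, l)])) u"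
    by (simp only: H_mult)
  have r: "\<phi> ((y, e) # (star, l) # u) = \<phi> (u @ [(y, e), (star, l)])" if "y \<in> V" for y
  proof -
    have "\<phi> ((y, e) # (star, l) # u) = (- 1) ^ Suc n * \<phi> ((star, l) # u @ [(y, e)])"
      using cyclic_cochainD[OF \<phi>, of "(star, l) # u" "(y, e)"] u G star e that by simp
    also have "\<phi> ((star, l) # u @ [(y, e)]) = (- 1) ^ Suc n * \<phi> (u @ [(y, e), (star, l)])"
      using cyclic_cochainD[OF \<phi>, of "u @ [(y, e)]" "(star, l)"] u G star e that by simp
    finally show ?thesis using s by (simp flip: mult.assoc)
  qed
  show "H \<phi> (z # u) = (- 1) ^ n * H \<phi> (u @ [z])"
    using r[of v] r[of star] G star u(1) h s
    unfolding z by (auto simp: H_snoc algebra_simps simp flip: mult.assoc)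
qed

section \<open>The augmentation onto words of the group\<close>

lemma tr_Cons: "tr \<phi> (a # w) = (if eps (fst a) then tr (\<lambda>u. \<phi> (snd a # u)) w else 0)"
  by (auto simp: tr_def)

lemma tr_diff: "tr (\<lambda>u. \<phi> u - \<psi> u) w = tr \<phi> w - tr \<psi> w"
  by (auto simp: tr_def)

lemma bar_tr: "bar lp lm (tr \<phi>) w = tr (bar (\<lambda>_ _. True) m \<phi>) w"
proof (induction w arbitrary: \<phi> rule: induct_list012)
  case (3 a b w)
  have "bar lp lm (tr (\<lambda>u. \<phi> (snd a # u))) (b # w) = tr (bar (\<lambda>_ _. True) m (\<lambda>u. \<phi> (snd a # u))) (b # w)"
    by (rule 3)
  then show ?case
    by (cases a; cases b) (auto simp: tr_Cons tr_diff)
qed (auto simp: tr_def)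

lemma hb_tr: "hb lp lm (tr \<phi>) w = tr (hb (\<lambda>_ _. True) m \<phi>) w"
proof (cases "2 \<le> length w")
  case True
  then obtain a u z where w: "w = a # u @ [z]" by (rule long_list_cases)
  have "wrap lp lm (tr \<phi>) w = tr (wrap (\<lambda>_ _. True) m \<phi>) w"
    unfolding w by (cases a; cases z) (auto simp: tr_def)
  then show ?thesis using True bar_tr[of \<phi> w] by (auto simp: hb_def tr_def)
qed (auto simp: hb_def tr_def)

lemma cyclic_cochain_tr:
  assumes \<phi>: "cyclic_cochain G n \<phi>"
  shows "cyclic_cochain (V \<times> G) n (tr \<phi>)"
  unfolding cyclic_cochain_def
proof (intro allI impI)
  fix z u assume u: "length u = n" "set (z # u) \<subseteq> V \<times> G"
  then have "snd ` set u \<subseteq> G" by auto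
  with u show "tr \<phi> (z # u) = (- 1) ^ n * tr \<phi> (u @ [z])"
    using cyclic_cochainD[OF \<phi>, of "map snd u" "snd z"] by (auto simp: tr_def)
qed

section \<open>Triangularity of \<open>Num\<close> and vanishing of cocycles\<close>

definition nonstar :: "('v \<times> 'l) list \<Rightarrow> nat" where
  "nonstar w = length (filter (\<lambda>a. fst a \<noteq> star) w)"

text \<open>A letter at \<open>star\<close> contributes zero. Any other letter contributes
  \<open>\<phi> w\<close>, up to a value at a word with one nontrivial letter fewer. So
  \<open>Num\<close> is triangular for the filtration by \<open>nonstar\<close>, with
  \<open>nonstar w\<close> on the diagonal.\<close>

lemma Num_minimal:
  assumes "\<And>u. length u = length w \<Longrightarrow> set u \<subseteq> V \<times> G \<Longrightarrow> nonstar u < nonstar w \<Longrightarrow> \<phi> u = 0"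
    "set w \<subseteq> V \<times> G"
  shows "Num \<phi> w = of_nat (nonstar w) * \<phi> w"
  using assms
proof (induction \<phi> w rule: Num.induct)
  case (2 \<phi> v l w)
  have "Num (\<lambda>u. \<phi> ((v, l) # u)) w = of_nat (nonstar w) * \<phi> ((v, l) # w)"
    using "2.prems" by (intro "2.IH") (auto simp: nonstar_def)
  moreover have "\<phi> ((star, l) # w) = 0" if "v \<noteq> star"
    using "2.prems" that star by (auto simp: nonstar_def)
  ultimately show ?case by (auto simp: nonstar_def star algebra_simps)
qed (simp add: nonstar_def)

text \<open>\<open>Num\<close> acts as \<open>k\<close> modulo words with fewer than \<open>k\<close> nontrivial junctions and is null-homotopic
  by \<open>hb_H\<close>, so subtracting \<open>Num \<phi> / k\<close> removes these words one degree at a time.\<close>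

lemma cocycle_vanishes:
  fixes \<phi> :: "('v \<times> 'l) list \<Rightarrow> 'k::field_char_0" and E :: "(('v \<times> 'l) list \<Rightarrow> 'k) \<Rightarrow> 'k"
  assumes E_lin: "\<And>\<phi> \<psi> c. E (\<lambda>u. \<phi> u - c * \<psi> u) = E \<phi> - c * E \<psi>"
    and E_cong: "\<And>\<phi> \<psi>. (\<And>w. w \<in> words (V \<times> G) n \<Longrightarrow> \<phi> w = \<psi> w) \<Longrightarrow> E \<phi> = E \<psi>"
    and E_hb: "\<And>\<psi>. 0 < n \<Longrightarrow> cyclic_cochain (V \<times> G) (n - 1) \<psi> \<Longrightarrow> E (hb lp lm \<psi>) = 0"
    and cyc: "cyclic_cochain (V \<times> G) n \<phi>"
    and coc: "\<And>w. w \<in> words (V \<times> G) (Suc n) \<Longrightarrow> hb lp lm \<phi> w = 0"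
    and low: "\<And>w. w \<in> words (V \<times> G) n \<Longrightarrow> nonstar w < k \<Longrightarrow> \<phi> w = 0"
    and k: "0 < k"
  shows "E \<phi> = 0"
  using cyc coc low k
proof (induction "Suc (Suc n) - k" arbitrary: \<phi> k)
  case 0
  \<comment> \<open>Here \<open>k\<close> is at least \<open>n + 2\<close>, while words of degree
    \<open>n\<close> have only \<open>n + 1\<close> letters.\<close>
  have "nonstar w < k" if "w \<in> words (V \<times> G) n" for w
    using 0(1) that length_filter_le[of "\<lambda>a. fst a \<noteq> star" w] by (simp add: nonstar_def words_def)
  then have "E \<phi> = E (\<lambda>u. \<phi> u - 1 * \<phi> u)"
    using 0 by (intro E_cong) auto
  then show ?case using E_lin[of \<phi> 1 \<phi>] by simp
next
  case (Suc d)
  let ?c = "1 / of_nat k :: 'k"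
  let ?\<psi> = "\<lambda>u. \<phi> u - ?c * Num \<phi> u"
  have E0: "E (\<lambda>u. 0) = 0" using E_lin[of "\<lambda>u. 0" 1 "\<lambda>u. 0"] by simp
  \<comment> \<open>On cocycles the second term of \<open>hb_H\<close> drops out, so
    \<open>Num \<phi>\<close> is a coboundary.\<close>
  have "E (Num \<phi>) = E (hb lp lm (H \<phi>))"
  proof (rule E_cong)
    fix w assume w: "w \<in> words (V \<times> G) n"
    have "H (hb lp lm \<phi>) w = H (\<lambda>u. 0) w"
      using w Suc.prems(2) by (intro H_cong) (auto simp: words_def)
    then show "Num \<phi> w = hb lp lm (H \<phi>) w"
      using hb_H[OF Suc.prems(1) w] by simp
  qed
  also have "\<dots> = 0"
  proof (cases n)
    case 0
    then have "E (hb lp lm (H \<phi>)) = E (\<lambda>u. 0)"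
      by (intro E_cong) (auto simp: hb_def words_def)
    then show ?thesis by (simp add: E0)
  next
    case (Suc j)
    then show ?thesis using cyclic_cochain_H[of j \<phi>] \<open>cyclic_cochain (V \<times> G) n \<phi>\<close> by (intro E_hb) auto
  qed
  finally have "E \<phi> = E ?\<psi>" unfolding E_lin by simp
  also have "\<dots> = 0"
  proof (rule Suc.hyps(1)[of "Suc k"])
    show "d = Suc (Suc n) - Suc k" "0 < Suc k" using Suc.hyps by auto
    show "cyclic_cochain (V \<times> G) n ?\<psi>"
      using Suc.prems(1) cyclic_cochain_Num[OF Suc.prems(1)]
      unfolding cyclic_cochain_def by (simp add: algebra_simps)
  next
    fix w assume w: "w \<in> words (V \<times> G) (Suc n)"
    have "Num (hb lp lm \<phi>) w = Num (\<lambda>u. 0) w"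
      using w Suc.prems(2) by (intro Num_cong) (auto simp: words_def)
    then show "hb lp lm ?\<psi> w = 0"
      using w Suc.prems(2)[OF w] hb_Num[of w \<phi>] unfolding hb_diff hb_mult by (simp add: words_def)
  next
    fix w assume w: "w \<in> words (V \<times> G) n" "nonstar w < Suc k"
    have "Num \<phi> w = of_nat (nonstar w) * \<phi> w"
      using w Suc.prems(3) by (intro Num_minimal) (auto simp: words_def)
    moreover have "\<phi> w = 0" if "nonstar w \<noteq> k"
      using that w Suc.prems(3) by auto
    ultimately show "?\<psi> w = 0"
      using Suc.prems(4) by (cases "nonstar w = k") auto
  qed
  finally show ?case .
qed

end

section \<open>Multilinear extension of cochains\<close>

fun ml :: "('a list \<Rightarrow> 'k::field) \<Rightarrow> ('a \<Rightarrow>\<^sub>0 'k) list \<Rightarrow> 'k" where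
  "ml \<phi> [] = \<phi> []"
| "ml \<phi> (b # bs) = ev (\<lambda>a. ml (\<lambda>w. \<phi> (a # w)) bs) b"

lemma ml_cong:
  assumes "\<And>w. length w = length bs \<Longrightarrow> set w \<subseteq> S \<Longrightarrow> \<phi> w = \<psi> w"
    "\<And>b. b \<in> set bs \<Longrightarrow> Poly_Mapping.keys b \<subseteq> S"
  shows "ml \<phi> bs = ml \<psi> bs"
  using assms
proof (induction bs arbitrary: \<phi> \<psi>)
  case (Cons b bs)
  have "ml (\<lambda>w. \<phi> (a # w)) bs = ml (\<lambda>w. \<psi> (a # w)) bs" if "a \<in> Poly_Mapping.keys b" for a
    using Cons.prems(2) that by (intro Cons.IH Cons.prems(1)) auto
  then show ?case by (auto intro: ev_cong)
qed simp

lemma ml_diff: "ml (\<lambda>w. \<phi> w - \<psi> w) bs = ml \<phi> bs - ml \<psi> bs"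
  by (induction bs arbitrary: \<phi> \<psi>) (auto simp: ev_fun_diff)

lemma ml_mult: "ml (\<lambda>w. c * \<phi> w) bs = c * ml \<phi> bs"
  by (induction bs arbitrary: \<phi>) (auto simp: ev_fun_mult)

lemma ml_fun_add: "ml (\<lambda>w. \<phi> w + \<psi> w) bs = ml \<phi> bs + ml \<psi> bs"
  by (induction bs arbitrary: \<phi> \<psi>) (auto simp: ev_fun_add)

lemma ml_zero [simp]: "ml (\<lambda>w. 0) = (\<lambda>bs. 0)"
proof
  show "ml (\<lambda>w. 0) bs = (0::'b)" for bs by (induction bs) auto
qed

lemma ml_ev: "ml (\<lambda>w. ev (\<lambda>x. F x w) f) bs = ev (\<lambda>x. ml (F x) bs) f"
proof (induction bs arbitrary: F)
  case (Cons b bs)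
  then show ?case using ev_commute[of "\<lambda>a x. ml (\<lambda>w. F x (a # w)) bs" f b] by simp
qed simp

lemma ml_append: "ml \<phi> (xs @ ys) = ml (\<lambda>u. ml (\<lambda>v. \<phi> (u @ v)) ys) xs"
  by (induction xs arbitrary: \<phi>) auto

lemma ml_basis [simp]: "ml \<phi> (map (\<lambda>a. Poly_Mapping.single a 1) w) = \<phi> w"
  by (induction w arbitrary: \<phi>) auto

lemma ml_add: "ml \<phi> (xs @ (a + b) # ys) = ml \<phi> (xs @ a # ys) + ml \<phi> (xs @ b # ys)"
  by (simp add: ml_append ev_add ml_fun_add)

lemma ml_scale: "ml \<phi> (xs @ pm_scale c a # ys) = c * ml \<phi> (xs @ a # ys)"
  by (simp add: ml_append ev_scale ml_mult)

text \<open>Multiplies a tuple of algebra elements out into basis words. The trace is given on basis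
  words only and is extended to tuples in this way.\<close>

fun expand :: "('a \<Rightarrow>\<^sub>0 'k::field) list \<Rightarrow> ('a list \<Rightarrow>\<^sub>0 'k)" where
  "expand [] = Poly_Mapping.single [] 1"
| "expand (b # bs) = lin_ext (\<lambda>a. lin_ext (\<lambda>w. Poly_Mapping.single (a # w) 1) (expand bs)) b"

lemma ev_expand: "ev \<phi> (expand bs) = ml \<phi> bs"
  by (induction bs arbitrary: \<phi>) (auto simp: ev_lin_ext)

lemma ev_ml_diff: "ev (ml (\<lambda>w. \<phi> w - \<psi> w)) f = ev (ml \<phi>) f - ev (ml \<psi>) f"
  by (simp add: ev_def ml_diff algebra_simps sum_subtractf)

lemma ev_ml_mult: "ev (ml (\<lambda>w. c * \<phi> w)) f = c * ev (ml \<phi>) f"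
  by (simp add: ev_def ml_mult sum_distrib_left mult.left_commute)

lemma keys_expand:
  assumes "\<And>b. b \<in> set bs \<Longrightarrow> Poly_Mapping.keys b \<subseteq> S"
  shows "Poly_Mapping.keys (expand bs) \<subseteq> {w. length w = length bs \<and> set w \<subseteq> S}"
  using assms
proof (induction bs)
  case (Cons b bs)
  have IH: "Poly_Mapping.keys (expand bs) \<subseteq> {w. length w = length bs \<and> set w \<subseteq> S}"
    using Cons by auto
  have "Poly_Mapping.keys (lin_ext (\<lambda>w. Poly_Mapping.single (a # w) 1) (expand bs))
      \<subseteq> {w. length w = length (b # bs) \<and> set w \<subseteq> S}" if "a \<in> Poly_Mapping.keys b" for a
    using keys_lin_ext[of "\<lambda>w. Poly_Mapping.single (a # w) 1" "expand bs"] IH Cons.prems[of b] that by fastforce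
  then show ?case
    using keys_lin_ext[of "\<lambda>a. lin_ext (\<lambda>w. Poly_Mapping.single (a # w) 1) (expand bs)" b] by fastforce
qed simp

lemma bar_ev: "bar p m (\<lambda>u. ev (\<lambda>x. F x u) f) w = ev (\<lambda>x. bar p m (F x) w) f"
proof (induction w arbitrary: F rule: induct_list012)
  case (3 a b w)
  show ?case using "3.IH"(2)[of "\<lambda>x u. F x (a # u)"] by (simp add: ev_fun_diff)
qed auto

text \<open>The product of algebra elements is total, so the predicate is constantly true; this
  instance of \<open>bar\<close> is the one that matches the inner faces of the Hochschild
  boundary.\<close>

lemma bar_eq_sum:
  "bar (\<lambda>_ _. True) M \<Phi> w =
    (\<Sum>k<length w - 1. (- 1) ^ k * \<Phi> (take k w @ M (w ! k) (w ! Suc k) # drop (k + 2) w))"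
proof (induction w arbitrary: \<Phi> rule: induct_list012)
  case (3 a b w)
  show ?case
    using "3.IH"(2)[of "\<lambda>u. \<Phi> (a # u)"]
    by (simp add: sum.lessThan_Suc_shift sum_negf del: sum.lessThan_Suc)
qed auto

section \<open>Connes' complex of an algebra with a multiplicative basis\<close>

locale monomial_algebra =
  fixes S :: "'a set" and p :: "'a \<Rightarrow> 'a \<Rightarrow> bool" and m :: "'a \<Rightarrow> 'a \<Rightarrow> 'a"
  assumes m_closed: "a \<in> S \<Longrightarrow> b \<in> S \<Longrightarrow> p a b \<Longrightarrow> m a b \<in> S"
begin

definition A :: "('k::field, 'a \<Rightarrow>\<^sub>0 'k) kalgebra" where
  "A = basis_algebra S (\<lambda>a b. if p a b then Poly_Mapping.single (m a b) 1 else 0)"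

lemma A_simps [simp]:
  "carrier A = {f. Poly_Mapping.keys f \<subseteq> S}" "vadd A = (+)" "vscale A = pm_scale"
  by (simp_all add: A_def basis_algebra_def free_vspace_def vspace.defs kalgebra.defs)

lemma ev_vmult: "ev \<psi> (vmult A f g) = ev (\<lambda>a. ev (\<lambda>b. if p a b then \<psi> (m a b) else 0) g) f"
proof -
  have "vmult A f g = lin_ext (\<lambda>a. lin_ext (\<lambda>b. if p a b then Poly_Mapping.single (m a b) 1 else 0) g) f"
    by (simp add: A_def basis_algebra_def free_vspace_def vspace.defs kalgebra.defs)
  moreover have "ev \<psi> (if p a b then Poly_Mapping.single (m a b) 1 else 0) = (if p a b then \<psi> (m a b) else 0)" for a b
    by simp
  ultimately show ?thesis by (simp only: ev_lin_ext)
qed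

lemma keys_vmult:
  fixes f g :: "'a \<Rightarrow>\<^sub>0 'k::field"
  assumes "Poly_Mapping.keys f \<subseteq> S" "Poly_Mapping.keys g \<subseteq> S"
  shows "Poly_Mapping.keys (vmult A f g) \<subseteq> S"
proof
  fix x assume x: "x \<in> Poly_Mapping.keys (vmult A f g)"
  show "x \<in> S"
  proof (rule ccontr)
    assume nx: "x \<notin> S"
    let ?\<psi> = "\<lambda>y. if y = x then 1 else 0 :: 'k"
    have "ev ?\<psi> (vmult A f g) = ev (\<lambda>a. ev (\<lambda>b. 0) g) f"
      unfolding ev_vmult using assms m_closed nx by (intro ev_cong) auto
    moreover have "ev ?\<psi> (vmult A f g) = Poly_Mapping.lookup (vmult A f g) x"
      by (auto simp: ev_def if_distrib in_keys_iff cong: if_cong)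
    ultimately show False using x by (simp add: in_keys_iff)
  qed
qed

lemma bar_ml: "bar (\<lambda>_ _. True) (vmult A) (ml \<phi>) bs = ml (bar p m \<phi>) bs"
proof (induction bs arbitrary: \<phi> rule: induct_list012)
  case (3 b c bs)
  have 1: "ml \<phi> (vmult A b c # bs) = ev (\<lambda>a. ev (\<lambda>d. ml (\<lambda>w. if p a d then \<phi> (m a d # w) else 0) bs) c) b"
  proof -
    have "(if p a d then ml (\<lambda>w. \<phi> (m a d # w)) bs else 0) = ml (\<lambda>w. if p a d then \<phi> (m a d # w) else 0) bs" for a d
      by simp
    then show ?thesis by (simp add: ev_vmult)
  qed
  have 2: "bar (\<lambda>_ _. True) (vmult A) (\<lambda>u. ml \<phi> (b # u)) (c # bs) = ev (\<lambda>a. ml (bar p m (\<lambda>w. \<phi> (a # w))) (c # bs)) b"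
    using "3.IH"(2) by (simp only: ml.simps(2)[of \<phi>] bar_ev)
  show ?case
    by (simp only: bar.simps(1) if_True 1 2) (simp add: ml_diff ev_fun_diff)
qed auto

lemma wrap_ml: "wrap (\<lambda>_ _. True) (vmult A) (ml \<phi>) (b # bs @ [c]) = ml (wrap p m \<phi>) (b # bs @ [c])"
proof -
  have "ml (wrap p m \<phi>) (b # bs @ [c]) = ev (\<lambda>a. ml (\<lambda>u. ev (\<lambda>d. if p d a then \<phi> (m d a # u) else 0) c) bs) b"
    by (simp add: ml_append)
  also have "\<dots> = ev (\<lambda>a. ev (\<lambda>d. ml (\<lambda>u. if p d a then \<phi> (m d a # u) else 0) bs) c) b"
    by (simp add: ml_ev)
  \<comment> \<open>The last entry is the left factor of the wrapped product, so it has to be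
    evaluated first.\<close>
  also have "\<dots> = ev (\<lambda>d. ev (\<lambda>a. ml (\<lambda>u. if p d a then \<phi> (m d a # u) else 0) bs) b) c"
    by (rule ev_commute)
  also have "(\<lambda>d a. ml (\<lambda>u. if p d a then \<phi> (m d a # u) else 0) bs) =
      (\<lambda>d a. if p d a then ml (\<lambda>u. \<phi> (m d a # u)) bs else 0)"
    by (auto simp: fun_eq_iff)
  finally show ?thesis by (simp add: ev_vmult)
qed

text \<open>The same \<open>hb\<close> is used twice: with the total product on tuples of algebra
  elements, and with the partial product on basis words. Multilinear extension intertwines the
  two.\<close>

lemma hb_ml: "hb (\<lambda>_ _. True) (vmult A) (ml \<phi>) bs = ml (hb p m \<phi>) bs"
proof (cases "2 \<le> length bs")
  case True
  let ?s = "(- 1) ^ (length bs - 1)"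
  obtain b r c where bs: "bs = b # r @ [c]" using True by (rule long_list_cases)
  have "ml (hb p m \<phi>) bs = ml (\<lambda>w. bar p m \<phi> w + ?s * wrap p m \<phi> w) bs"
    using True by (intro ml_cong[of _ UNIV]) (auto simp: hb_def)
  also have "\<dots> = bar (\<lambda>_ _. True) (vmult A) (ml \<phi>) bs + ?s * wrap (\<lambda>_ _. True) (vmult A) (ml \<phi>) bs"
    unfolding ml_fun_add ml_mult bar_ml bs wrap_ml ..
  finally show ?thesis using True by (simp add: hb_def)
next
  case False
  have "ml (hb p m \<phi>) bs = ml (\<lambda>w. 0) bs"
    using False by (intro ml_cong[of _ UNIV]) (auto simp: hb_def)
  then show ?thesis using False by (simp add: hb_def)
qed

abbreviation Tup :: "nat \<Rightarrow> ('a \<Rightarrow>\<^sub>0 'k::field) list set" where "Tup n \<equiv> tuples A n"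

definition Ch :: "nat \<Rightarrow> (('a \<Rightarrow>\<^sub>0 'k::field) list \<Rightarrow>\<^sub>0 'k) set" where
  "Ch n = {f. Poly_Mapping.keys f \<subseteq> Tup n}"

definition boundary :: "nat \<Rightarrow> (('a \<Rightarrow>\<^sub>0 'k::field) list \<Rightarrow>\<^sub>0 'k) \<Rightarrow> (('a \<Rightarrow>\<^sub>0 'k) list \<Rightarrow>\<^sub>0 'k)" where
  "boundary n = lin_ext (\<lambda>bs. \<Sum>k\<le>Suc n. Poly_Mapping.single (face A (Suc n) k bs) ((- 1) ^ k))"

definition rotation :: "nat \<Rightarrow> (('a \<Rightarrow>\<^sub>0 'k::field) list \<Rightarrow>\<^sub>0 'k) \<Rightarrow> (('a \<Rightarrow>\<^sub>0 'k) list \<Rightarrow>\<^sub>0 'k)" where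
  "rotation n = lin_ext (\<lambda>bs. Poly_Mapping.single (last bs # butlast bs) ((- 1) ^ n))"

definition cocycle :: "nat \<Rightarrow> ('a list \<Rightarrow> 'k::field) \<Rightarrow> bool" where
  "cocycle n \<phi> \<longleftrightarrow> (\<forall>w\<in>words S (Suc n). hb p m \<phi> w = 0)"

text \<open>By \<open>Rel_decomposition\<close>, these sums represent the tensors in the image of 1
  - \<tau>.\<close>

definition Rel :: "nat \<Rightarrow> (('a \<Rightarrow>\<^sub>0 'k::field) list \<Rightarrow>\<^sub>0 'k) set" where
  "Rel n = {f \<in> Ch n. \<forall>\<phi>. cyclic_cochain S n \<phi> \<longrightarrow> ev (ml \<phi>) f = 0}"

text \<open>By \<open>Bd_decomposition\<close>, these are the boundaries up to elements of
  \<open>Rel n\<close>.\<close>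

definition Bd :: "nat \<Rightarrow> (('a \<Rightarrow>\<^sub>0 'k::field) list \<Rightarrow>\<^sub>0 'k) set" where
  "Bd n = {f \<in> Ch n. \<forall>\<phi>. cyclic_cochain S n \<phi> \<longrightarrow> cocycle n \<phi> \<longrightarrow> ev (ml \<phi>) f = 0}"

text \<open>For positive \<open>n\<close> this says that the boundary lies in
  \<open>Rel (n - 1)\<close>, with the boundary moved to the cochain; in degree zero every chain is
  a cycle.\<close>

definition Cyc :: "nat \<Rightarrow> (('a \<Rightarrow>\<^sub>0 'k::field) list \<Rightarrow>\<^sub>0 'k) set" where
  "Cyc n = {f \<in> Ch n. 0 < n \<longrightarrow> (\<forall>\<phi>. cyclic_cochain S (n - 1) \<phi> \<longrightarrow> ev (ml (hb p m \<phi>)) f = 0)}"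

lemma subspace_Ch: "pm.subspace (Ch n :: (('a \<Rightarrow>\<^sub>0 'k::field) list \<Rightarrow>\<^sub>0 'k) set)"
  unfolding Ch_def by (rule subspace_free)

lemma subspace_annihilator:
  "pm.subspace {f \<in> Ch n. \<forall>\<phi>. P \<phi> \<longrightarrow> ev (F \<phi>) f = (0::'k::field)}"
  by (auto intro!: pm.subspaceI simp: ev_add ev_scale pm.subspace_0[OF subspace_Ch]
      pm.subspace_add[OF subspace_Ch] pm.subspace_scale[OF subspace_Ch])

lemma subspace_Rel: "pm.subspace (Rel n)"
  unfolding Rel_def by (rule subspace_annihilator)

lemma subspace_Bd: "pm.subspace (Bd n :: (('a \<Rightarrow>\<^sub>0 'k::field) list \<Rightarrow>\<^sub>0 'k) set)"
  using subspace_annihilator[of n "\<lambda>\<phi> :: 'a list \<Rightarrow> 'k. cyclic_cochain S n \<phi> \<and> cocycle n \<phi>" ml]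
  unfolding Bd_def by (simp add: imp_conjL)

lemma subspace_Cyc: "pm.subspace (Cyc n :: (('a \<Rightarrow>\<^sub>0 'k::field) list \<Rightarrow>\<^sub>0 'k) set)"
  using subspace_annihilator[of n "\<lambda>\<phi> :: 'a list \<Rightarrow> 'k. 0 < n \<and> cyclic_cochain S (n - 1) \<phi>" "\<lambda>\<phi>. ml (hb p m \<phi>)"]
  unfolding Cyc_def by (cases "0 < n") simp_all

lemma Rel_Ch: "Rel n \<subseteq> Ch n" by (auto simp: Rel_def)
lemma Bd_Ch: "Bd n \<subseteq> Ch n" by (auto simp: Bd_def)
lemma Cyc_Ch: "Cyc n \<subseteq> Ch n" by (auto simp: Cyc_def)
lemma Rel_Bd: "Rel n \<subseteq> Bd n" by (auto simp: Rel_def Bd_def)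

lemma Tup_iff: "bs \<in> Tup n \<longleftrightarrow> length bs = Suc n \<and> (\<forall>b\<in>set bs. Poly_Mapping.keys b \<subseteq> S)"
  by (auto simp: tuples_def)

lemma map_single_Tup: "w \<in> words S n \<Longrightarrow> map (\<lambda>a. Poly_Mapping.single a 1) w \<in> Tup n"
  by (auto simp: words_def tuples_def)

lemma ml_cong_Ch:
  assumes "\<And>w. w \<in> words S n \<Longrightarrow> \<phi> w = \<psi> w" "f \<in> Ch n"
  shows "ev (ml \<phi>) f = ev (ml \<psi>) f"
proof (intro ev_cong ml_cong[of _ S])
  fix bs w assume "bs \<in> Poly_Mapping.keys f" "length w = length bs" "set w \<subseteq> S"
  then show "\<phi> w = \<psi> w" using assms by (auto simp: Ch_def tuples_def words_def subset_iff)
next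
  fix bs b assume "bs \<in> Poly_Mapping.keys f" "b \<in> set bs"
  then show "Poly_Mapping.keys b \<subseteq> S" using assms by (auto simp: Ch_def tuples_def)
qed

lemma lin_ext_Ch:
  fixes f :: "('a \<Rightarrow>\<^sub>0 'k::field) list \<Rightarrow>\<^sub>0 'k" and F :: "('a \<Rightarrow>\<^sub>0 'k) list \<Rightarrow> (('a \<Rightarrow>\<^sub>0 'k) list \<Rightarrow>\<^sub>0 'k)"
  assumes "\<And>bs. bs \<in> Tup n \<Longrightarrow> F bs \<in> Ch j" "f \<in> Ch n"
  shows "lin_ext F f \<in> Ch j"
  unfolding lin_ext_def using assms
  by (intro pm.subspace_sum[OF subspace_Ch] pm.subspace_scale[OF subspace_Ch]) (auto simp: Ch_def)

lemma single_Ch: "bs \<in> Tup n \<Longrightarrow> Poly_Mapping.single bs c \<in> Ch n"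
  by (auto simp: Ch_def)

lemma face_Tup:
  assumes bs: "bs \<in> Tup (Suc n)" and k: "k \<le> Suc n"
  shows "face A (Suc n) k bs \<in> Tup n"
proof -
  have l: "length bs = Suc (Suc n)" "\<And>b. b \<in> set bs \<Longrightarrow> Poly_Mapping.keys b \<subseteq> S"
    using bs by (auto simp: tuples_def)
  have n: "Poly_Mapping.keys (bs ! i) \<subseteq> S" if "i < Suc (Suc n)" for i
    using l that by auto
  have "set (tl (butlast bs)) \<subseteq> set bs"
    by (cases bs) (auto dest: in_set_butlastD split: if_splits)
  then show ?thesis
    using l n k keys_vmult[of "bs ! k" "bs ! Suc k"] keys_vmult[of "bs ! Suc n" "bs ! 0"]
    by (auto simp: Tup_iff face_def dest!: in_set_takeD in_set_dropD)
qed

lemma boundary_Ch: "f \<in> Ch (Suc n) \<Longrightarrow> boundary n f \<in> Ch n"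
  unfolding boundary_def
  by (rule lin_ext_Ch[where n = "Suc n"])
    (auto intro!: pm.subspace_sum[OF subspace_Ch] single_Ch face_Tup simp del: sum.atMost_Suc)

lemma rotation_Ch: "f \<in> Ch n \<Longrightarrow> rotation n f \<in> Ch n"
  unfolding rotation_def
proof (rule lin_ext_Ch[where n = n])
  fix bs :: "('a \<Rightarrow>\<^sub>0 'b) list" assume bs: "bs \<in> Tup n"
  then have "bs \<noteq> []" by (auto simp: tuples_def)
  then obtain u z where "bs = u @ [z]" by (cases bs rule: rev_cases) auto
  with bs show "Poly_Mapping.single (last bs # butlast bs) ((- 1) ^ n) \<in> Ch n"
    by (intro single_Ch) (auto simp: tuples_def)
qed

section \<open>Evaluation of cochains on boundaries and rotations\<close>

lemma face_sum_eq_hb: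
  assumes "length bs = Suc (Suc n)"
  shows "(\<Sum>k\<le>Suc n. (- 1) ^ k * \<Phi> (face A (Suc n) k bs)) = hb (\<lambda>_ _. True) (vmult A) \<Phi> bs"
proof -
  have "hd bs = bs ! 0" "last bs = bs ! Suc n"
    using assms by (cases "bs = []"; simp add: hd_conv_nth last_conv_nth)+
  then show ?thesis
    using assms by (simp add: hb_def bar_eq_sum wrap_def face_def lessThan_Suc_atMost[symmetric])
qed

lemma ev_boundary:
  assumes "f \<in> Ch (Suc n)"
  shows "ev (ml \<phi>) (boundary n f) = ev (ml (hb p m \<phi>)) f"
  unfolding boundary_def ev_lin_ext
proof (rule ev_cong)
  fix bs assume "bs \<in> Poly_Mapping.keys f"
  then have "length bs = Suc (Suc n)" using assms by (auto simp: Ch_def tuples_def)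
  then show "ev (ml \<phi>) (\<Sum>k\<le>Suc n. Poly_Mapping.single (face A (Suc n) k bs) ((- 1) ^ k)) = ml (hb p m \<phi>) bs"
    using face_sum_eq_hb[of bs n "ml \<phi>"] by (simp only: ev_sum ev_single hb_ml)
qed

lemma ev_rotation:
  assumes "f \<in> Ch n" "cyclic_cochain S n \<phi>"
  shows "ev (ml \<phi>) (rotation n f) = ev (ml \<phi>) f"
  unfolding rotation_def ev_lin_ext
proof (rule ev_cong)
  fix bs assume "bs \<in> Poly_Mapping.keys f"
  then have bs: "length bs = Suc n" "\<And>b. b \<in> set bs \<Longrightarrow> Poly_Mapping.keys b \<subseteq> S"
    using assms by (auto simp: Ch_def tuples_def)
  then obtain u z where uz: "bs = u @ [z]" by (cases bs rule: rev_cases) auto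
  have s: "(- 1) ^ n * (- 1) ^ n = (1::'b)" by (simp flip: power_mult_distrib)
  have "ml \<phi> (z # u) = ev (\<lambda>a. ml (\<lambda>w. (- 1) ^ n * \<phi> (w @ [a])) u) z"
    using bs uz assms(2) by (auto intro!: ev_cong ml_cong[of _ S] simp: cyclic_cochain_def)
  also have "\<dots> = (- 1) ^ n * ml \<phi> (u @ [z])"
    by (simp add: ml_mult ml_append ml_ev ev_fun_mult)
  finally show "ev (ml \<phi>) (Poly_Mapping.single (last bs # butlast bs) ((- 1) ^ n)) = ml \<phi> bs"
    using uz s by (simp flip: mult.assoc)
qed

text \<open>Killing the tensor relations means being linear in every entry, so the values on tuples
  of basis elements determine the functional.\<close>

lemma functional_eq_ml:
  fixes \<Phi> :: "('a \<Rightarrow>\<^sub>0 'k::field) list \<Rightarrow> 'k"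
  assumes "\<And>f. f \<in> tensor_relations A n \<Longrightarrow> ev \<Phi> f = 0"
  shows "bs \<in> Tup n \<Longrightarrow> \<Phi> bs = ml (\<lambda>w. \<Phi> (map (\<lambda>a. Poly_Mapping.single a 1) w)) bs"
proof -
  let ?d = "map (\<lambda>a. Poly_Mapping.single a (1::'k))"
  have add: "\<Phi> (xs @ (a + b) # ys) = \<Phi> (xs @ a # ys) + \<Phi> (xs @ b # ys)"
    if "length xs + length ys = n" "set xs \<union> set ys \<union> {a, b} \<subseteq> carrier A" for xs ys a b
  proof -
    have "ev \<Phi> (Poly_Mapping.single (xs @ vadd A a b # ys) 1
         - Poly_Mapping.single (xs @ a # ys) 1 - Poly_Mapping.single (xs @ b # ys) 1) = 0"
      using that unfolding tensor_relations_def
      by (intro assms[unfolded tensor_relations_def] pm.span_base UnI1 CollectI exI conjI) (rule refl)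
    then show ?thesis by (simp add: ev_diff) (simp add: diff_eq_eq add.commute)
  qed
  have scale: "\<Phi> (xs @ pm_scale c a # ys) = c * \<Phi> (xs @ a # ys)"
    if "length xs + length ys = n" "set xs \<union> set ys \<union> {a} \<subseteq> carrier A" for xs ys a c
  proof -
    have "ev \<Phi> (Poly_Mapping.single (xs @ vscale A c a # ys) 1 - Poly_Mapping.single (xs @ a # ys) c) = 0"
      using that unfolding tensor_relations_def
      by (intro assms[unfolded tensor_relations_def] pm.span_base UnI2 CollectI exI conjI) (rule refl)
    then show ?thesis by (simp add: ev_diff)
  qed
  \<comment> \<open>The entries are expanded from left to right; \<open>us\<close> holds those
    already replaced by basis elements.\<close>
  have *: "\<Phi> (us @ bs) = ml (\<lambda>w. \<Phi> (us @ ?d w)) bs" if "us @ bs \<in> Tup n" for us bs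
    using that
  proof (induction bs arbitrary: us)
    case (Cons b bs)
    have us: "length us + length bs = n" "set us \<subseteq> carrier A" "set bs \<subseteq> carrier A" "Poly_Mapping.keys b \<subseteq> S"
      using Cons.prems by (auto simp: tuples_def)
    have "\<Phi> (us @ b # bs) = ev (\<lambda>a. \<Phi> (us @ Poly_Mapping.single a 1 # bs)) b"
      using us add[of us bs] scale[of us bs] by (intro linear_eq_ev[of S "\<lambda>b. \<Phi> (us @ b # bs)"]) auto
    also have "\<dots> = ev (\<lambda>a. ml (\<lambda>w. \<Phi> (us @ Poly_Mapping.single a 1 # ?d w)) bs) b"
    proof (rule ev_cong)
      fix a assume "a \<in> Poly_Mapping.keys b"
      then have "(us @ [Poly_Mapping.single a 1]) @ bs \<in> Tup n" using us by (auto simp: tuples_def)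
      from Cons.IH[OF this] show "\<Phi> (us @ Poly_Mapping.single a 1 # bs) = ml (\<lambda>w. \<Phi> (us @ Poly_Mapping.single a 1 # ?d w)) bs"
        by simp
    qed
    finally show ?case by simp
  qed simp
  show "\<Phi> bs = ml (\<lambda>w. \<Phi> (?d w)) bs" if "bs \<in> Tup n" using *[of "[]" bs] that by simp
qed

lemma ev_functional_eq_ml:
  fixes \<Phi> :: "('a \<Rightarrow>\<^sub>0 'k::field) list \<Rightarrow> 'k"
  assumes "\<And>f. f \<in> tensor_relations A n \<Longrightarrow> ev \<Phi> f = 0" "f \<in> Ch n"
  shows "ev \<Phi> f = ev (ml (\<lambda>w. \<Phi> (map (\<lambda>a. Poly_Mapping.single a 1) w))) f"
  using assms by (intro ev_cong functional_eq_ml[of n]) (auto simp: Ch_def)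

text \<open>A formal sum killed by all multilinear extensions but outside the relations would be
  separated from them by some functional; by \<open>functional_eq_ml\<close> that functional is
  itself a multilinear extension.\<close>

lemma tensor_relations_eq: "tensor_relations A n = {f \<in> Ch n. \<forall>\<phi>. ev (ml \<phi>) f = (0::'k::field)}"
  (is "_ = ?T")
proof
  have T: "pm.subspace ?T" using subspace_annihilator[of n "\<lambda>_. True" ml] by simp
  show "tensor_relations A n \<subseteq> ?T"
    unfolding tensor_relations_def
  proof (rule pm.span_minimal[OF _ T], intro subsetI, elim UnE CollectE exE conjE)
    fix f :: "('a \<Rightarrow>\<^sub>0 'k) list \<Rightarrow>\<^sub>0 'k" and xs ys a b
    assume f: "f = Poly_Mapping.single (xs @ vadd A a b # ys) 1
         - Poly_Mapping.single (xs @ a # ys) 1 - Poly_Mapping.single (xs @ b # ys) 1"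
      and l: "length xs + length ys = n" "set xs \<union> set ys \<union> {a, b} \<subseteq> carrier A"
    have "a + b \<in> carrier A" using l(2) keys_add[of a b] by auto
    then have "f \<in> Ch n" unfolding f using l
      by (intro pm.subspace_diff[OF subspace_Ch] single_Ch) (auto simp: tuples_def)
    then show "f \<in> ?T" using f by (auto simp: ev_diff ml_add)
  next
    fix f :: "('a \<Rightarrow>\<^sub>0 'k) list \<Rightarrow>\<^sub>0 'k" and xs ys a c
    assume f: "f = Poly_Mapping.single (xs @ vscale A c a # ys) 1 - Poly_Mapping.single (xs @ a # ys) c"
      and l: "length xs + length ys = n" "set xs \<union> set ys \<union> {a} \<subseteq> carrier A"
    have "pm_scale c a \<in> carrier A" using l(2) keys_pm_scale[of c a] by auto
    then have "f \<in> Ch n" unfolding f using l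
      by (intro pm.subspace_diff[OF subspace_Ch] single_Ch) (auto simp: tuples_def)
    then show "f \<in> ?T" using f by (auto simp: ev_diff ml_scale)
  qed
  show "?T \<subseteq> tensor_relations A n"
  proof (rule subsetI, rule ccontr)
    fix f assume f: "f \<in> ?T" "f \<notin> tensor_relations A n"
    have "pm.subspace (tensor_relations A n :: (('a \<Rightarrow>\<^sub>0 'k) list \<Rightarrow>\<^sub>0 'k) set)"
      unfolding tensor_relations_def by (rule pm.subspace_span)
    then obtain \<Phi> where \<Phi>: "\<forall>u\<in>tensor_relations A n. ev \<Phi> u = 0" "ev \<Phi> f \<noteq> 0"
      using subspace_separation f(2) by blast
    then show False using f(1) ev_functional_eq_ml[of n \<Phi> f] by auto
  qed
qed

end

section \<open>Presentation of cyclic homology\<close>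

context monomial_algebra
begin

definition proj\<^sub>T :: "nat \<Rightarrow> (('a \<Rightarrow>\<^sub>0 'k::field) list \<Rightarrow>\<^sub>0 'k) \<Rightarrow> (('a \<Rightarrow>\<^sub>0 'k) list \<Rightarrow>\<^sub>0 'k) set" where
  "proj\<^sub>T n = vcoset (free_vspace (Tup n)) (tensor_relations A n)"

definition proj\<^sub>R :: "nat \<Rightarrow> (('a \<Rightarrow>\<^sub>0 'k::field) list \<Rightarrow>\<^sub>0 'k) \<Rightarrow> (('a \<Rightarrow>\<^sub>0 'k) list \<Rightarrow>\<^sub>0 'k) set set" where
  "proj\<^sub>R n f = vcoset (tensor_power A n) (proj\<^sub>T n ` Rel n) (proj\<^sub>T n f)"

lemma subspace_tensor_relations: "pm.subspace (tensor_relations A n)"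
  unfolding tensor_relations_def by (rule pm.subspace_span)

lemma tensor_relations_Ch: "tensor_relations A n \<subseteq> Ch n"
  by (auto simp: tensor_relations_eq)

lemma tensor_relations_Rel: "tensor_relations A n \<subseteq> Rel n"
  by (auto simp: tensor_relations_eq Rel_def)

lemma presents_Ch: "presents (Ch n) {0} id (free_vspace (Tup n))"
  unfolding Ch_def by (rule presents_free)

lemma presents_tensor_power: "presents (Ch n) (tensor_relations A n) (proj\<^sub>T n) (tensor_power A n)"
proof -
  have "{0} \<subseteq> tensor_relations A n"
    using pm.subspace_0[OF subspace_tensor_relations] by simp
  from presents_vquot_UNIV[OF presents_Ch subspace_tensor_relations tensor_relations_Ch this]
  show ?thesis by (simp add: tensor_power_def proj\<^sub>T_def)
qed

lemma tensor_map_proj: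
  assumes F: "F = lin_ext \<phi>" "F ` Ch j \<subseteq> Ch n" "F ` tensor_relations A j \<subseteq> tensor_relations A n"
    and c: "c \<in> Ch j"
  shows "tensor_map A n \<phi> (proj\<^sub>T j c) = proj\<^sub>T n (F c)"
proof -
  have "{0} \<subseteq> tensor_relations A n"
    using pm.subspace_0[OF subspace_tensor_relations] by simp
  from presents_induced[OF presents_Ch subspace_tensor_relations tensor_relations_Ch
      presents_Ch subspace_tensor_relations tensor_relations_Ch this, of j F F c] F c
  show ?thesis by (simp add: tensor_map_def proj\<^sub>T_def lin_ext_add)
qed

lemma rotation_relations: "rotation n ` tensor_relations A n \<subseteq> tensor_relations A n"
proof clarify
  fix f :: "('a \<Rightarrow>\<^sub>0 'b) list \<Rightarrow>\<^sub>0 'b" assume f: "f \<in> tensor_relations A n"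
  have "ev (ml \<phi>) (rotation n f) = 0" for \<phi>
  proof -
    have "ev (ml \<phi>) (rotation n f) = ev (ml (\<lambda>w. (- 1) ^ n * \<phi> (last w # butlast w))) f"
      unfolding rotation_def ev_lin_ext
    proof (rule ev_cong)
      fix bs assume "bs \<in> Poly_Mapping.keys f"
      then have "length bs = Suc n" using f by (auto simp: tensor_relations_eq Ch_def tuples_def)
      then obtain u z where uz: "bs = u @ [z]" by (cases bs rule: rev_cases) auto
      show "ev (ml \<phi>) (Poly_Mapping.single (last bs # butlast bs) ((- 1) ^ n)) =
          ml (\<lambda>w. (- 1) ^ n * \<phi> (last w # butlast w)) bs"
        unfolding uz by (simp add: ml_mult ml_append ml_ev)
    qed
    then show ?thesis using f by (simp add: tensor_relations_eq)
  qed
  then show "rotation n f \<in> tensor_relations A n"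
    using f rotation_Ch by (auto simp: tensor_relations_eq)
qed

lemma cyclic_operator_proj:
  assumes "c \<in> Ch n"
  shows "cyclic_operator A n (proj\<^sub>T n c) = proj\<^sub>T n (rotation n c)"
  unfolding cyclic_operator_def
  using rotation_Ch by (intro tensor_map_proj[OF rotation_def _ rotation_relations assms]) auto

lemma boundary_relations: "boundary n ` tensor_relations A (Suc n) \<subseteq> tensor_relations A n"
  using boundary_Ch by (auto simp: tensor_relations_eq ev_boundary)

lemma hochschild_boundary_proj:
  assumes "c \<in> Ch (Suc n)"
  shows "hochschild_boundary A n (proj\<^sub>T (Suc n) c) = proj\<^sub>T n (boundary n c)"
  unfolding hochschild_boundary_def
  using boundary_Ch by (intro tensor_map_proj[OF boundary_def _ boundary_relations assms]) auto

lemma proj\<^sub>T_eq_iff: "a \<in> Ch n \<Longrightarrow> b \<in> Ch n \<Longrightarrow> proj\<^sub>T n a = proj\<^sub>T n b \<longleftrightarrow> a - b \<in> tensor_relations A n"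
  by (rule presents_eq_iff[OF presents_tensor_power])

text \<open>Double annihilator argument: a functional that kills all \<open>c - rotation n c\<close>
  and the tensor relations restricts to a cyclic cochain on basis words, and so kills
  \<open>f\<close>.\<close>

lemma Rel_decomposition:
  fixes f :: "('a \<Rightarrow>\<^sub>0 'k::field) list \<Rightarrow>\<^sub>0 'k"
  assumes "f \<in> Rel n"
  shows "\<exists>c\<in>Ch n. f - (c - rotation n c) \<in> tensor_relations A n"
proof -
  let ?U = "{c - rotation n c + t |c t. c \<in> Ch n \<and> t \<in> tensor_relations A n} :: (('a \<Rightarrow>\<^sub>0 'k) list \<Rightarrow>\<^sub>0 'k) set"
  note sT = subspace_tensor_relations[of n, where ?'b = 'k]
  have U: "pm.subspace ?U"
  proof (rule pm.subspaceI)
    show "0 \<in> ?U" using pm.subspace_0[OF subspace_Ch] pm.subspace_0[OF sT]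
      by (intro CollectI exI[of _ 0] conjI) (auto simp: rotation_def)
  next
    fix x y assume "x \<in> ?U" "y \<in> ?U"
    then obtain c t c' t' where "x = c - rotation n c + t" "y = c' - rotation n c' + t'"
      "c \<in> Ch n" "t \<in> tensor_relations A n" "c' \<in> Ch n" "t' \<in> tensor_relations A n" by blast
    then show "x + y \<in> ?U" using pm.subspace_add[OF subspace_Ch] pm.subspace_add[OF sT]
      by (intro CollectI exI[of _ "c + c'"] exI[of _ "t + t'"] conjI) (auto simp: rotation_def lin_ext_add)
  next
    fix a x assume "x \<in> ?U"
    then obtain c t where "x = c - rotation n c + t" "c \<in> Ch n" "t \<in> tensor_relations A n" by blast
    then show "pm_scale a x \<in> ?U" using pm.subspace_scale[OF subspace_Ch] pm.subspace_scale[OF sT]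
      by (intro CollectI exI[of _ "pm_scale a c"] exI[of _ "pm_scale a t"] conjI)
        (auto simp: rotation_def lin_ext_scale pm.scale_right_distrib pm.scale_right_diff_distrib)
  qed
  have "f \<in> ?U"
  proof (rule ccontr)
    assume "f \<notin> ?U"
    from subspace_separation[OF U this]
    obtain \<Phi> where \<Phi>0: "\<forall>u\<in>?U. ev \<Phi> u = 0" "ev \<Phi> f \<noteq> 0"
      by (elim exE conjE)
    note \<Phi> = bspec[OF \<Phi>0(1)] \<Phi>0(2)
    have T: "ev \<Phi> t = 0" if "t \<in> tensor_relations A n" for t
      using that pm.subspace_0[OF subspace_Ch]
      by (intro \<Phi>(1) CollectI exI[of _ 0] exI[of _ t] conjI) (auto simp: rotation_def)
    have R: "ev \<Phi> c = ev \<Phi> (rotation n c)" if "c \<in> Ch n" for c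
    proof -
      have "ev \<Phi> (c - rotation n c) = 0"
        using that pm.subspace_0[OF sT] by (intro \<Phi>(1) CollectI exI[of _ c] exI[of _ 0] conjI) auto
      then show ?thesis by (simp add: ev_diff)
    qed
    let ?d = "map (\<lambda>a. Poly_Mapping.single a (1::'k))"
    let ?\<phi> = "\<lambda>w. \<Phi> (?d w)"
    have "cyclic_cochain S n ?\<phi>"
      unfolding cyclic_cochain_def
    proof (intro allI impI)
      fix z u assume zu: "length u = n" "set (z # u) \<subseteq> S"
      have "?d (u @ [z]) \<in> Tup n" using zu by (intro map_single_Tup) (auto simp: words_def)
      from R[OF single_Ch[OF this, of 1]] have "\<Phi> (?d (u @ [z])) = (- 1) ^ n * \<Phi> (?d (z # u))"
        by (simp add: rotation_def butlast_append pm_scale_single)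
      then have "(- 1) ^ n * \<Phi> (?d (u @ [z])) = ((- 1) ^ n * (- 1) ^ n) * \<Phi> (?d (z # u))"
        by simp
      then show "\<Phi> (?d (z # u)) = (- 1) ^ n * \<Phi> (?d (u @ [z]))"
        by (simp flip: power_mult_distrib)
    qed
    then have "ev (ml ?\<phi>) f = 0" using assms by (auto simp: Rel_def)
    then show False using \<Phi>(2) ev_functional_eq_ml[of n \<Phi> f] T assms by (auto simp: Rel_def)
  qed
  then obtain c t where ct: "f = c - rotation n c + t" "c \<in> Ch n" "t \<in> tensor_relations A n" by blast
  then show ?thesis by (intro bexI[of _ c]) auto
qed

lemma carrier_tensor_power: "carrier (tensor_power A n) = proj\<^sub>T n ` Ch n"
  by (rule presents_carrier[OF presents_tensor_power])

lemma cyclic_relations_eq: "cyclic_relations A n = proj\<^sub>T n ` (Rel n :: (('a \<Rightarrow>\<^sub>0 'k::field) list \<Rightarrow>\<^sub>0 'k) set)"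
proof -
  have rep: "vadd (tensor_power A n) (proj\<^sub>T n c) (vscale (tensor_power A n) (- 1) (cyclic_operator A n (proj\<^sub>T n c)))
      = proj\<^sub>T n (c - rotation n c)" if "c \<in> Ch n" for c :: "('a \<Rightarrow>\<^sub>0 'k) list \<Rightarrow>\<^sub>0 'k"
  proof -
    have "- rotation n c \<in> Ch n" using pm.subspace_neg[OF subspace_Ch] rotation_Ch that by blast
    then show ?thesis
      using rotation_Ch[OF that] that
      by (simp add: presents_add[OF presents_tensor_power] presents_scale[OF presents_tensor_power]
          cyclic_operator_proj pm_scale_m1)
  qed
  have "cyclic_relations A n = (\<lambda>c. proj\<^sub>T n (c - rotation n c)) ` (Ch n :: (('a \<Rightarrow>\<^sub>0 'k) list \<Rightarrow>\<^sub>0 'k) set)"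
    unfolding cyclic_relations_def Let_def carrier_tensor_power image_image by (rule image_cong[OF refl rep])
  also have "\<dots> = proj\<^sub>T n ` Rel n"
  proof (intro subset_antisym subsetI; elim imageE)
    fix x and c :: "('a \<Rightarrow>\<^sub>0 'k) list \<Rightarrow>\<^sub>0 'k" assume "x = proj\<^sub>T n (c - rotation n c)" "c \<in> Ch n"
    moreover have "c - rotation n c \<in> Rel n"
      using \<open>c \<in> Ch n\<close> pm.subspace_diff[OF subspace_Ch \<open>c \<in> Ch n\<close> rotation_Ch[OF \<open>c \<in> Ch n\<close>]]
      by (auto simp: Rel_def ev_diff ev_rotation)
    ultimately show "x \<in> proj\<^sub>T n ` Rel n" by blast
  next
    fix x and f :: "('a \<Rightarrow>\<^sub>0 'k) list \<Rightarrow>\<^sub>0 'k" assume x: "x = proj\<^sub>T n f" and f: "f \<in> Rel n"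
    obtain c where c: "c \<in> Ch n" "f - (c - rotation n c) \<in> tensor_relations A n"
      using Rel_decomposition[OF f] by blast
    have "c - rotation n c \<in> Ch n" using c rotation_Ch pm.subspace_diff[OF subspace_Ch] by blast
    then have "x = proj\<^sub>T n (c - rotation n c)"
      using x c f proj\<^sub>T_eq_iff[of f n "c - rotation n c"] Rel_Ch by blast
    with c show "x \<in> (\<lambda>c. proj\<^sub>T n (c - rotation n c)) ` Ch n" by blast
  qed
  finally show ?thesis .
qed

lemma presents_connes_space: "presents (Ch n) (Rel n) (proj\<^sub>R n) (connes_space A n)"
  using presents_vquot_UNIV[OF presents_tensor_power subspace_Rel Rel_Ch tensor_relations_Rel]
  by (simp add: connes_space_def cyclic_relations_eq proj\<^sub>R_def[abs_def])

lemma carrier_connes_space: "carrier (connes_space A n) = proj\<^sub>R n ` Ch n"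
  by (rule presents_carrier[OF presents_connes_space])

lemma boundary_Rel: "boundary n ` Rel (Suc n) \<subseteq> Rel n"
  using boundary_Ch by (auto simp: Rel_def ev_boundary cyclic_cochain_hb m_closed)

lemma boundary_add: "boundary n (f + g) = boundary n f + boundary n g"
  by (simp add: boundary_def lin_ext_add)

lemma connes_boundary_proj:
  assumes "c \<in> Ch (Suc n)"
  shows "connes_boundary A n (proj\<^sub>R (Suc n) c) = proj\<^sub>R n (boundary n c)"
  unfolding connes_boundary_def proj\<^sub>R_def cyclic_relations_eq
  by (rule presents_induced[OF presents_tensor_power subspace_Rel Rel_Ch
      presents_tensor_power subspace_Rel Rel_Ch tensor_relations_Rel])
    (use assms boundary_Rel boundary_Ch in \<open>auto simp: hochschild_boundary_proj boundary_add\<close>)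

lemma connes_cycles_eq: "connes_cycles A n = proj\<^sub>R n ` Cyc n"
proof (cases n)
  case 0
  have "Cyc 0 = (Ch 0 :: (('a \<Rightarrow>\<^sub>0 'b) list \<Rightarrow>\<^sub>0 'b) set)" by (auto simp: Cyc_def)
  then show ?thesis using 0 by (simp add: connes_cycles_def presents_carrier[OF presents_connes_space])
next
  case (Suc j)
  \<comment> \<open>Vanishing in the Connes space means that the representative
    \<open>boundary j c\<close> lies in \<open>Rel j\<close>; \<open>ev_boundary\<close> moves this
    onto cochains.\<close>
  have eq: "connes_boundary A j (proj\<^sub>R (Suc j) c) = vzero (connes_space A j) \<longleftrightarrow> c \<in> Cyc (Suc j)"
    if c: "c \<in> Ch (Suc j)" for c :: "('a \<Rightarrow>\<^sub>0 'b) list \<Rightarrow>\<^sub>0 'b"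
  proof -
    have 0: "0 \<in> Ch j" by (rule pm.subspace_0[OF subspace_Ch])
    have "connes_boundary A j (proj\<^sub>R (Suc j) c) = vzero (connes_space A j) \<longleftrightarrow> boundary j c - 0 \<in> Rel j"
      using boundary_Ch[OF c] 0
      unfolding connes_boundary_proj[OF c] presents_zero[OF presents_connes_space]
      by (intro presents_eq_iff[OF presents_connes_space])
    also have "\<dots> \<longleftrightarrow> c \<in> Cyc (Suc j)"
      using boundary_Ch[OF c] c by (auto simp: Rel_def Cyc_def ev_boundary)
    finally show ?thesis .
  qed
  show ?thesis
    using eq Cyc_Ch[of "Suc j"] unfolding Suc connes_cycles_def by (auto simp: carrier_connes_space)
qed

text \<open>Double annihilator argument again: a functional that kills \<open>Rel n\<close> is a
  cyclic cochain on basis words, and if it also kills boundaries that cochain is a cocycle, so it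
  kills \<open>f\<close>.\<close>

lemma Bd_decomposition:
  fixes f :: "('a \<Rightarrow>\<^sub>0 'k::field) list \<Rightarrow>\<^sub>0 'k"
  assumes "f \<in> Bd n"
  shows "\<exists>c\<in>Ch (Suc n). f - boundary n c \<in> Rel n"
proof -
  let ?U = "{boundary n c + t |c t. c \<in> Ch (Suc n) \<and> t \<in> Rel n} :: (('a \<Rightarrow>\<^sub>0 'k) list \<Rightarrow>\<^sub>0 'k) set"
  have U: "pm.subspace ?U"
  proof (rule pm.subspaceI)
    show "0 \<in> ?U" using pm.subspace_0[OF subspace_Ch] pm.subspace_0[OF subspace_Rel]
      by (intro CollectI exI[of _ 0] conjI) (auto simp: boundary_def)
  next
    fix x y assume "x \<in> ?U" "y \<in> ?U"
    then obtain c t c' t' where "x = boundary n c + t" "y = boundary n c' + t'"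
      "c \<in> Ch (Suc n)" "t \<in> Rel n" "c' \<in> Ch (Suc n)" "t' \<in> Rel n" by blast
    then show "x + y \<in> ?U" using pm.subspace_add[OF subspace_Ch] pm.subspace_add[OF subspace_Rel]
      by (intro CollectI exI[of _ "c + c'"] exI[of _ "t + t'"] conjI) (auto simp: boundary_add)
  next
    fix a x assume "x \<in> ?U"
    then obtain c t where "x = boundary n c + t" "c \<in> Ch (Suc n)" "t \<in> Rel n" by blast
    then show "pm_scale a x \<in> ?U" using pm.subspace_scale[OF subspace_Ch] pm.subspace_scale[OF subspace_Rel]
      by (intro CollectI exI[of _ "pm_scale a c"] exI[of _ "pm_scale a t"] conjI)
        (auto simp: boundary_def lin_ext_scale pm.scale_right_distrib)
  qed
  have "f \<in> ?U"
  proof (rule ccontr)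
    assume "f \<notin> ?U"
    from subspace_separation[OF U this]
    obtain \<Phi> where \<Phi>0: "\<forall>u\<in>?U. ev \<Phi> u = 0" "ev \<Phi> f \<noteq> 0"
      by (elim exE conjE)
    note \<Phi> = bspec[OF \<Phi>0(1)] \<Phi>0(2)
    have R: "ev \<Phi> t = 0" if "t \<in> Rel n" for t
      using that pm.subspace_0[OF subspace_Ch]
      by (intro \<Phi>(1) CollectI exI[of _ 0] exI[of _ t] conjI) (auto simp: boundary_def)
    have B: "ev \<Phi> (boundary n c) = 0" if "c \<in> Ch (Suc n)" for c
      using that pm.subspace_0[OF subspace_Rel] by (intro \<Phi>(1) CollectI exI[of _ c] exI[of _ 0] conjI) auto
    have T: "ev \<Phi> t = 0" if "t \<in> tensor_relations A n" for t
      using that R tensor_relations_Rel by blast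
    let ?d = "map (\<lambda>a. Poly_Mapping.single a (1::'k))"
    let ?\<phi> = "\<lambda>w. \<Phi> (?d w)"
    have eq: "ev \<Phi> g = ev (ml ?\<phi>) g" if "g \<in> Ch n" for g
      using ev_functional_eq_ml[of n \<Phi> g] T that by blast
    have "cyclic_cochain S n ?\<phi>"
      unfolding cyclic_cochain_def
    proof (intro allI impI)
      fix z u assume zu: "length u = n" "set (z # u) \<subseteq> S"
      let ?g = "Poly_Mapping.single (?d (z # u)) 1 - Poly_Mapping.single (?d (u @ [z])) ((- 1) ^ n)"
      have "?d (u @ [z]) \<in> Tup n" "?d (z # u) \<in> Tup n"
        using zu by (intro map_single_Tup; auto simp: words_def)+
      then have "?g \<in> Rel n"
        using zu by (auto simp: Rel_def ev_diff ev_uminus cyclic_cochain_def simp del: map_append list.map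
            intro!: pm.subspace_diff[OF subspace_Ch] single_Ch)
      from R[OF this] show "\<Phi> (?d (z # u)) = (- 1) ^ n * \<Phi> (?d (u @ [z]))"
        by (simp add: ev_diff)
    qed
    moreover have "cocycle n ?\<phi>"
      unfolding cocycle_def
    proof
      fix w assume "w \<in> words S (Suc n)"
      then have c: "Poly_Mapping.single (?d w) 1 \<in> Ch (Suc n)" by (intro single_Ch map_single_Tup)
      have "ev (ml ?\<phi>) (boundary n (Poly_Mapping.single (?d w) 1)) = 0"
        using B[OF c] eq[OF boundary_Ch[OF c]] by simp
      then show "hb p m ?\<phi> w = 0"
        unfolding ev_boundary[OF c] by simp
    qed
    ultimately have "ev (ml ?\<phi>) f = 0" using assms by (auto simp: Bd_def)
    then show False using \<Phi>(2) eq[of f] assms Bd_Ch by auto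
  qed
  then obtain c t where ct: "f = boundary n c + t" "c \<in> Ch (Suc n)" "t \<in> Rel n" by blast
  then show ?thesis by (intro bexI[of _ c]) auto
qed

lemma connes_boundary_image:
  "connes_boundary A n ` carrier (connes_space A (Suc n)) = proj\<^sub>R n ` (Bd n :: (('a \<Rightarrow>\<^sub>0 'k::field) list \<Rightarrow>\<^sub>0 'k) set)"
proof -
  have "connes_boundary A n ` carrier (connes_space A (Suc n)) =
      (\<lambda>c. proj\<^sub>R n (boundary n c)) ` (Ch (Suc n) :: (('a \<Rightarrow>\<^sub>0 'k) list \<Rightarrow>\<^sub>0 'k) set)"
    by (simp add: image_image connes_boundary_proj carrier_connes_space)
  also have "\<dots> = proj\<^sub>R n ` Bd n"
  proof (intro subset_antisym subsetI; elim imageE)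
    fix x and c :: "('a \<Rightarrow>\<^sub>0 'k) list \<Rightarrow>\<^sub>0 'k" assume x: "x = proj\<^sub>R n (boundary n c)" and c: "c \<in> Ch (Suc n)"
    have "ev (ml \<phi>) (boundary n c) = 0" if "cocycle n \<phi>" for \<phi>
      using ml_cong_Ch[of "Suc n" "hb p m \<phi>" "\<lambda>_. 0" c] that c
      by (simp add: ev_boundary cocycle_def)
    then have "boundary n c \<in> Bd n" using boundary_Ch[OF c] by (auto simp: Bd_def)
    with x show "x \<in> proj\<^sub>R n ` Bd n" by blast
  next
    fix x and f :: "('a \<Rightarrow>\<^sub>0 'k) list \<Rightarrow>\<^sub>0 'k" assume x: "x = proj\<^sub>R n f" and f: "f \<in> Bd n"
    obtain c where c: "c \<in> Ch (Suc n)" "f - boundary n c \<in> Rel n"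
      using Bd_decomposition[OF f] by blast
    then have "x = proj\<^sub>R n (boundary n c)"
      using x f presents_eq_iff[OF presents_connes_space, of f n "boundary n c"] boundary_Ch[OF c(1)] Bd_Ch
      by blast
    with c show "x \<in> (\<lambda>c. proj\<^sub>R n (boundary n c)) ` Ch (Suc n)" by blast
  qed
  finally show ?thesis .
qed

lemma presents_HC:
  "presents (Cyc n) (Bd n) (\<lambda>f. vcoset (connes_space A n) (proj\<^sub>R n ` Bd n) (proj\<^sub>R n f)) (HC n A)"
  using presents_vquot[OF presents_connes_space subspace_Bd Bd_Ch Rel_Bd subspace_Cyc Cyc_Ch]
  by (simp add: HC_def connes_cycles_eq connes_boundary_image)

end

section \<open>Cyclic words in a connected groupoid\<close>

text \<open>The path at \<open>x\<close> is normalised to the identity so that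
  \<open>loop_of\<close> fixes loops. A word of loops is then encoded with all junctions equal to
  \<open>(x, x)\<close>, and pulling a group cochain back along the encoding leaves its values on
  such words unchanged.\<close>

locale based_groupoid = groupoid C for C :: "('o, 'm) small_category" +
  fixes x :: 'o and from_x to_x :: "'o \<Rightarrow> 'm"
  assumes x: "x \<in> Obj C"
    and from_x: "y \<in> Obj C \<Longrightarrow> from_x y \<in> Arr C \<and> Src C (from_x y) = x \<and> Tgt C (from_x y) = y"
    and to_x: "y \<in> Obj C \<Longrightarrow> to_x y \<in> Arr C \<and> Src C (to_x y) = y \<and> Tgt C (to_x y) = x"
    and to_from: "y \<in> Obj C \<Longrightarrow> Comp C (to_x y) (from_x y) = Ident C x"
    and from_to: "y \<in> Obj C \<Longrightarrow> Comp C (from_x y) (to_x y) = Ident C y"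
    and at_x: "from_x x = Ident C x" "to_x x = Ident C x"
begin

definition loops :: "'m set" where "loops = {l \<in> Arr C. Src C l = x \<and> Tgt C l = x}"

definition loop_of :: "'m \<Rightarrow> 'm" where
  "loop_of g = Comp C (to_x (Tgt C g)) (Comp C g (from_x (Src C g)))"

definition arrow :: "'o \<Rightarrow> 'o \<Rightarrow> 'm \<Rightarrow> 'm" where
  "arrow s t l = Comp C (from_x t) (Comp C l (to_x s))"

lemmas cat_simps = Src_Obj Tgt_Obj Ident_Arr Src_Ident Tgt_Ident Comp_Arr Src_Comp Tgt_Comp Comp_assoc
  Comp_Ident_left Comp_Ident_right from_x to_x to_from from_to x

lemma cancel_from_to: "g \<in> Arr C \<Longrightarrow> Tgt C g = y \<Longrightarrow> Comp C (from_x y) (Comp C (to_x y) g) = g"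
  using Comp_assoc[of "from_x y" "to_x y" g] from_x to_x from_to Tgt_Obj Comp_Ident_left by metis

lemma cancel_to_from: "g \<in> Arr C \<Longrightarrow> Tgt C g = x \<Longrightarrow> y \<in> Obj C \<Longrightarrow> Comp C (to_x y) (Comp C (from_x y) g) = g"
  using Comp_assoc[of "to_x y" "from_x y" g] Comp_Ident_left[of g] by (auto simp: cat_simps)

lemma Ident_right: "g \<in> Arr C \<Longrightarrow> Src C g = y \<Longrightarrow> Comp C g (Ident C y) = g"
  using Comp_Ident_right[of g] by auto

lemma Ident_left: "g \<in> Arr C \<Longrightarrow> Tgt C g = y \<Longrightarrow> Comp C (Ident C y) g = g"
  using Comp_Ident_left[of g] by auto

lemma loop_of_loops: "g \<in> Arr C \<Longrightarrow> loop_of g \<in> loops"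
  by (auto simp: loop_of_def loops_def cat_simps)

lemma loop_of_Comp:
  "g \<in> Arr C \<Longrightarrow> h \<in> Arr C \<Longrightarrow> Src C g = Tgt C h \<Longrightarrow> loop_of (Comp C g h) = Comp C (loop_of g) (loop_of h)"
  by (simp add: loop_of_def cat_simps cancel_from_to)

lemma loop_of_loop: "l \<in> loops \<Longrightarrow> loop_of l = l"
  by (auto simp: loop_of_def loops_def at_x Ident_left Ident_right)

lemma arrow:
  assumes "s \<in> Obj C" "t \<in> Obj C" "l \<in> loops"
  shows "arrow s t l \<in> Arr C" "Src C (arrow s t l) = s" "Tgt C (arrow s t l) = t" "loop_of (arrow s t l) = l"
  using assms
  by (auto simp: arrow_def loop_of_def loops_def cat_simps cancel_to_from Ident_left Ident_right)

lemma arrow_loop_of: "g \<in> Arr C \<Longrightarrow> arrow (Src C g) (Tgt C g) (loop_of g) = g"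
  by (simp add: arrow_def loop_of_def cat_simps cancel_from_to Ident_left Ident_right)

abbreviation composable :: "'m \<Rightarrow> 'm \<Rightarrow> bool" where "composable g h \<equiv> Src C g = Tgt C h"

sublocale B: monomial_algebra "Arr C" composable "Comp C"
  by unfold_locales (rule Comp_Arr)

sublocale K: monomial_algebra loops "\<lambda>_ _. True" "Comp C"
  by unfold_locales (auto simp: loops_def cat_simps)

sublocale L: letters "\<lambda>v. fst v = snd v" "(x, x)" "Obj C \<times> Obj C" "Comp C" "Ident C x" loops
  by unfold_locales (auto simp: loops_def cat_simps Ident_left Ident_right)

abbreviation Letters :: "(('o \<times> 'o) \<times> 'm) set" where "Letters \<equiv> (Obj C \<times> Obj C) \<times> loops"

text \<open>The letter at an arrow \<open>g\<close> of a cyclic word consists of the junction between the previous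
  arrow and \<open>g\<close>, and the loop at \<open>x\<close> obtained from \<open>g\<close>; two neighbours are composable if and only if
  the junction between them is diagonal.\<close>

fun encode_from :: "'o \<Rightarrow> 'm list \<Rightarrow> (('o \<times> 'o) \<times> 'm) list" where
  "encode_from q [] = []"
| "encode_from q (g # w) = ((q, Tgt C g), loop_of g) # encode_from (Src C g) w"

definition encode :: "'m list \<Rightarrow> (('o \<times> 'o) \<times> 'm) list" where
  "encode w = encode_from (Src C (last w)) w"

text \<open>The source of an arrow is recorded in the junction of the next letter; for the last
  arrow it is the parameter \<open>q\<close>, which \<open>decode\<close> takes from the first
  letter.\<close>

fun decode_to :: "'o \<Rightarrow> (('o \<times> 'o) \<times> 'm) list \<Rightarrow> 'm list" where
  "decode_to q [] = []"
| "decode_to q (a # w) = arrow (if w = [] then q else fst (fst (hd w))) (snd (fst a)) (snd a) # decode_to q w"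

definition decode :: "(('o \<times> 'o) \<times> 'm) list \<Rightarrow> 'm list" where
  "decode w = decode_to (fst (fst (hd w))) w"

lemma length_encode_from [simp]: "length (encode_from q w) = length w"
  by (induction w arbitrary: q) auto

lemma length_encode [simp]: "length (encode w) = length w"
  by (simp add: encode_def)

lemma length_decode_to [simp]: "length (decode_to q w) = length w"
  by (induction w) auto

lemma encode_from_snoc:
  "encode_from q (w @ [g]) = encode_from q w @ [((if w = [] then q else Src C (last w), Tgt C g), loop_of g)]"
  by (induction w arbitrary: q) auto

lemma hd_encode_from: "w \<noteq> [] \<Longrightarrow> fst (fst (hd (encode_from q w))) = q"
  by (cases w) auto

lemma encode_from_empty [simp]: "encode_from q w = [] \<longleftrightarrow> w = []"
  by (cases w) auto

lemma decode_to_empty [simp]: "decode_to q w = [] \<longleftrightarrow> w = []"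
  by (cases w) auto

lemma set_encode_from: "q \<in> Obj C \<Longrightarrow> set w \<subseteq> Arr C \<Longrightarrow> set (encode_from q w) \<subseteq> Letters"
  by (induction w arbitrary: q) (auto simp: cat_simps loop_of_loops)

lemma encode_words: "w \<in> words (Arr C) n \<Longrightarrow> encode w \<in> words Letters n"
proof -
  assume w: "w \<in> words (Arr C) n"
  then have "w \<noteq> []" by (auto simp: words_def)
  then have "Src C (last w) \<in> Obj C" using w by (auto simp: words_def subset_iff Src_Obj)
  with w set_encode_from[OF this] show ?thesis by (auto simp: words_def encode_def)
qed

lemma set_decode_to: "q \<in> Obj C \<Longrightarrow> set w \<subseteq> Letters \<Longrightarrow> set (decode_to q w) \<subseteq> Arr C"
proof (induction w)
  case (Cons a w)
  have "fst (fst (hd w)) \<in> Obj C" if "w \<noteq> []" using Cons.prems that by (cases w) auto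
  then show ?case using Cons by (auto intro!: arrow)
qed simp

lemma decode_words: "w \<in> words Letters n \<Longrightarrow> decode w \<in> words (Arr C) n"
proof -
  assume w: "w \<in> words Letters n"
  then have "fst (fst (hd w)) \<in> Obj C" by (cases w) (auto simp: words_def)
  with w set_decode_to[OF this] show ?thesis by (auto simp: words_def decode_def)
qed

section \<open>The encoding is a bijection compatible with rotations and faces\<close>

lemma decode_to_encode_from:
  "w \<noteq> [] \<Longrightarrow> set w \<subseteq> Arr C \<Longrightarrow> Src C (last w) = q \<Longrightarrow> decode_to q (encode_from r w) = w"
proof (induction w arbitrary: r)
  case (Cons g w)
  then show ?case
    by (cases "w = []") (auto simp: hd_encode_from arrow_loop_of)
qed simp

lemma decode_encode: "w \<in> words (Arr C) n \<Longrightarrow> decode (encode w) = w"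
proof -
  assume w: "w \<in> words (Arr C) n"
  then have "w \<noteq> []" by (auto simp: words_def)
  with w show ?thesis
    by (simp add: decode_def encode_def hd_encode_from decode_to_encode_from words_def)
qed

lemma Src_last_decode_to:
  "w \<noteq> [] \<Longrightarrow> set w \<subseteq> Letters \<Longrightarrow> q \<in> Obj C \<Longrightarrow> Src C (last (decode_to q w)) = q"
  by (induction w) (auto intro!: arrow)

lemma encode_from_decode_to:
  "w \<noteq> [] \<Longrightarrow> set w \<subseteq> Letters \<Longrightarrow> q \<in> Obj C \<Longrightarrow> fst (fst (hd w)) = r \<Longrightarrow> encode_from r (decode_to q w) = w"
proof (induction w arbitrary: r)
  case (Cons a w)
  have "fst (fst (hd w)) \<in> Obj C" if "w \<noteq> []" using Cons.prems that by (cases w) auto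
  with Cons show ?case by (cases "w = []") (auto simp: arrow)
qed simp

lemma encode_decode: "w \<in> words Letters n \<Longrightarrow> encode (decode w) = w"
proof -
  assume w: "w \<in> words Letters n"
  then have "w \<noteq> []" "fst (fst (hd w)) \<in> Obj C" by (cases w; auto simp: words_def)+
  with w show ?thesis
    by (simp add: decode_def encode_def Src_last_decode_to encode_from_decode_to words_def)
qed

text \<open>A letter depends only on its arrow and the cyclic predecessor, so rotation moves letters
  without changing them.\<close>

lemma encode_rotate: "encode (g # w) = a # u \<Longrightarrow> encode (w @ [g]) = u @ [a]"
  by (auto simp: encode_def encode_from_snoc)

lemma encode_loops:
  assumes "w \<noteq> []" "set w \<subseteq> loops"
  shows "encode w = map (Pair (x, x)) w"
proof -
  have "encode_from x w = map (Pair (x, x)) w"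
    using assms(2) by (induction w) (auto simp: loop_of_loop loops_def)
  moreover have "last w \<in> loops"
    using assms last_in_set by blast
  then have "Src C (last w) = x" by (simp add: loops_def)
  ultimately show ?thesis by (simp add: encode_def)
qed

text \<open>Composing \<open>g\<close> with \<open>h\<close> deletes the junction between them and
  keeps the junction before \<open>g\<close> and the source of \<open>h\<close>, so no other letter
  changes. Inner faces also keep the source \<open>r\<close> of the last arrow; hence the agreement
  of \<open>\<phi>\<close> and \<open>\<psi>\<close> is needed only for words ending there.\<close>

lemma bar_encode_from:
  assumes "\<And>u. u \<noteq> [] \<Longrightarrow> Src C (last u) = r \<Longrightarrow> \<phi> u = \<psi> (encode_from q u)"
    "w \<noteq> []" "set w \<subseteq> Arr C" "Src C (last w) = r"
  shows "bar composable (Comp C) \<phi> w = bar L.lp L.lm \<psi> (encode_from q w)"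
  using assms
proof (induction composable "Comp C" \<phi> w arbitrary: \<psi> q rule: bar.induct)
  case (1 \<phi> g h w)
  have "bar composable (Comp C) (\<lambda>u. \<phi> (g # u)) (h # w)
      = bar L.lp L.lm (\<lambda>u. \<psi> (((q, Tgt C g), loop_of g) # u)) (encode_from (Src C g) (h # w))"
    using "1.prems" by (intro "1.hyps") auto
  moreover have "\<phi> (Comp C g h # w) = \<psi> (encode_from q (Comp C g h # w))" if "composable g h"
    using "1.prems" that by (intro "1.prems"(1)) (auto simp: Src_Comp)
  ultimately show ?case
    using "1.prems"(3) by (auto simp: Src_Comp Tgt_Comp loop_of_Comp)
qed auto

lemma wrap_encode:
  assumes "set (g # u @ [z]) \<subseteq> Arr C"
  shows "wrap composable (Comp C) (\<lambda>w. \<psi> (encode w)) (g # u @ [z]) = wrap L.lp L.lm \<psi> (encode (g # u @ [z]))"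
proof -
  have "encode (g # u @ [z]) = ((Src C z, Tgt C g), loop_of g) # encode_from (Src C g) u @
      [((if u = [] then Src C g else Src C (last u), Tgt C z), loop_of z)]"
    by (simp add: encode_def encode_from_snoc)
  then show ?thesis
    using assms by (auto simp: encode_def Src_Comp Tgt_Comp loop_of_Comp)
qed

lemma hb_encode:
  assumes "set w \<subseteq> Arr C"
  shows "hb composable (Comp C) (\<lambda>w. \<psi> (encode w)) w = hb L.lp L.lm \<psi> (encode w)"
proof (cases "2 \<le> length w")
  case True
  then obtain g u z where w: "w = g # u @ [z]" by (rule long_list_cases)
  have "bar composable (Comp C) (\<lambda>w. \<psi> (encode w)) w = bar L.lp L.lm \<psi> (encode w)"
    unfolding encode_def[of w]
    using w assms by (intro bar_encode_from) (auto simp: encode_def)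
  then show ?thesis
    using True wrap_encode[of g u z \<psi>] w assms by (simp add: hb_def)
qed (simp add: hb_def)

lemma cyclic_cochain_encode:
  assumes "cyclic_cochain Letters n \<psi>"
  shows "cyclic_cochain (Arr C) n (\<lambda>w. \<psi> (encode w))"
  unfolding cyclic_cochain_def
proof (intro allI impI)
  fix g w assume w: "length w = n" "set (g # w) \<subseteq> Arr C"
  then have gw: "encode (g # w) \<in> words Letters n" by (intro encode_words) (auto simp: words_def)
  then obtain a u where au: "encode (g # w) = a # u" by (cases "encode (g # w)") (auto simp: words_def)
  show "\<psi> (encode (g # w)) = (- 1) ^ n * \<psi> (encode (w @ [g]))"
    using gw unfolding encode_rotate[OF au] unfolding au
    by (intro cyclic_cochainD[OF assms]) (auto simp: words_def)
qed

lemma cyclic_cochain_decode: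
  assumes "cyclic_cochain (Arr C) n \<phi>"
  shows "cyclic_cochain Letters n (\<lambda>w. \<phi> (decode w))"
  unfolding cyclic_cochain_def
proof (intro allI impI)
  fix a u assume u: "length u = n" "set (a # u) \<subseteq> Letters"
  then have au: "a # u \<in> words Letters n" by (auto simp: words_def)
  obtain g w where gw: "decode (a # u) = g # w" by (cases "decode (a # u)") (auto simp: decode_def)
  have A: "g # w \<in> words (Arr C) n" using decode_words[OF au] gw by simp
  have "encode (g # w) = a # u" using encode_decode[OF au] gw by simp
  then have "encode (w @ [g]) = u @ [a]" by (rule encode_rotate)
  moreover have "w @ [g] \<in> words (Arr C) n" using A by (auto simp: words_def)
  ultimately have "decode (u @ [a]) = w @ [g]" using decode_encode by metis
  then show "\<phi> (decode (a # u)) = (- 1) ^ n * \<phi> (decode (u @ [a]))"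
    using A cyclic_cochainD[OF assms, of w g] unfolding gw by (simp add: words_def)
qed

lemma hb_decode:
  assumes "w \<in> words Letters (Suc n)"
  shows "hb L.lp L.lm (\<lambda>w. \<phi> (decode w)) w = hb composable (Comp C) \<phi> (decode w)"
proof -
  have w: "decode w \<in> words (Arr C) (Suc n)" by (rule decode_words[OF assms])
  have "hb L.lp L.lm (\<lambda>w. \<phi> (decode w)) w = hb L.lp L.lm (\<lambda>w. \<phi> (decode w)) (encode (decode w))"
    by (simp add: encode_decode[OF assms])
  also have "\<dots> = hb composable (Comp C) (\<lambda>w. \<phi> (decode (encode w))) (decode w)"
    using w by (subst hb_encode) (auto simp: words_def)
  also have "\<dots> = hb composable (Comp C) \<phi> (decode w)"
    using w by (intro hb_cong[of _ "Arr C"]) (auto simp: words_def cat_simps intro!: arg_cong[of _ _ \<phi>] decode_encode[of _ n])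
  finally show ?thesis .
qed

section \<open>Comparison of the two complexes\<close>

lemma loops_Arr: "loops \<subseteq> Arr C" by (auto simp: loops_def)

lemma cyclic_cochain_loops: "cyclic_cochain (Arr C) n \<phi> \<Longrightarrow> cyclic_cochain loops n \<phi>"
  using subset_trans[OF _ loops_Arr] unfolding cyclic_cochain_def by blast

lemma words_loops: "words loops n \<subseteq> words (Arr C) n"
  using loops_Arr by (auto simp: words_def)

lemma hb_loops: "w \<in> words loops n \<Longrightarrow> hb (\<lambda>_ _. True) (Comp C) \<phi> w = hb composable (Comp C) \<phi> w"
  using K.m_closed by (intro hb_cong[of _ loops]) (auto simp: words_def loops_def)

lemma map_snd_words: "w \<in> words Letters n \<Longrightarrow> map snd w \<in> words loops n"
  by (auto simp: words_def)

text \<open>Elements of the group algebra are combinations of arrows supported on loops, so its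
  chains are literally chains of the groupoid algebra.\<close>

lemma K_Ch_subset: "K.Ch n \<subseteq> B.Ch n"
  using loops_Arr by (auto simp: K.Ch_def B.Ch_def tuples_def subset_iff)

lemma K_Cyc_subset: "K.Cyc n \<subseteq> B.Cyc n"
proof
  fix f :: "('m \<Rightarrow>\<^sub>0 'k::field) list \<Rightarrow>\<^sub>0 'k" assume f: "f \<in> K.Cyc n"
  have fC: "f \<in> K.Ch n" using f K.Cyc_Ch by blast
  then have fB: "f \<in> B.Ch n" using K_Ch_subset by blast
  have "ev (ml (hb composable (Comp C) \<phi>)) f = 0" if "0 < n" "cyclic_cochain (Arr C) (n - 1) \<phi>" for \<phi>
  proof -
    have "ev (ml (hb composable (Comp C) \<phi>)) f = ev (ml (hb (\<lambda>_ _. True) (Comp C) \<phi>)) f"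
      by (intro K.ml_cong_Ch[OF _ fC]) (simp add: hb_loops)
    then show ?thesis using f that(1) cyclic_cochain_loops[OF that(2)] by (simp add: K.Cyc_def)
  qed
  then show "f \<in> B.Cyc n" using fB by (simp add: B.Cyc_def)
qed

lemma tr_encode_loops:
  assumes "w \<in> words loops n"
  shows "L.tr \<phi> (encode w) = \<phi> w"
proof -
  have "encode w = map (Pair (x, x)) w" using assms by (intro encode_loops) (auto simp: words_def)
  then show ?thesis by (simp add: L.tr_def comp_def)
qed

lemma cyclic_cochain_tr_encode: "cyclic_cochain loops n \<phi> \<Longrightarrow> cyclic_cochain (Arr C) n (\<lambda>w. L.tr \<phi> (encode w))"
  by (intro cyclic_cochain_encode L.cyclic_cochain_tr)

lemma hb_tr_encode:
  assumes "w \<in> words (Arr C) n"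
  shows "hb composable (Comp C) (\<lambda>w. L.tr \<phi> (encode w)) w = L.tr (hb (\<lambda>_ _. True) (Comp C) \<phi>) (encode w)"
  using assms by (subst hb_encode) (auto simp: L.hb_tr words_def)

text \<open>This gives injectivity. A group cocycle extends to a groupoid cocycle by
  \<open>L.tr\<close> and \<open>encode\<close>, and conversely a groupoid cocycle restricts to
  loops; both operations preserve the values on \<open>f\<close>.\<close>

lemma Bd_iff:
  fixes f :: "('m \<Rightarrow>\<^sub>0 'k::field) list \<Rightarrow>\<^sub>0 'k"
  assumes f: "f \<in> K.Ch n"
  shows "f \<in> B.Bd n \<longleftrightarrow> f \<in> K.Bd n"
proof
  assume B: "f \<in> B.Bd n"
  have "ev (ml \<phi>) f = 0" if \<phi>: "cyclic_cochain loops n \<phi>" "K.cocycle n \<phi>" for \<phi>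
  proof -
    let ?\<psi> = "\<lambda>w. L.tr \<phi> (encode w)"
    have "hb composable (Comp C) ?\<psi> w = 0" if w: "w \<in> words (Arr C) (Suc n)" for w
      using \<phi>(2) map_snd_words[OF encode_words[OF w]] unfolding hb_tr_encode[OF w]
      by (simp add: L.tr_def K.cocycle_def)
    then have "ev (ml ?\<psi>) f = 0"
      using B cyclic_cochain_tr_encode[OF \<phi>(1)] by (simp add: B.Bd_def B.cocycle_def)
    moreover have "ev (ml ?\<psi>) f = ev (ml \<phi>) f"
      by (intro K.ml_cong_Ch[OF _ f]) (simp add: tr_encode_loops)
    ultimately show ?thesis by simp
  qed
  then show "f \<in> K.Bd n" using f by (simp add: K.Bd_def)
next
  assume K: "f \<in> K.Bd n"
  have "ev (ml \<phi>) f = 0" if "cyclic_cochain (Arr C) n \<phi>" "B.cocycle n \<phi>" for \<phi>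
  proof -
    have "K.cocycle n \<phi>"
      using that(2) words_loops by (auto simp: K.cocycle_def B.cocycle_def hb_loops)
    then show ?thesis using K cyclic_cochain_loops[OF that(1)] by (simp add: K.Bd_def)
  qed
  moreover have "f \<in> B.Ch n" using f K_Ch_subset by blast
  ultimately show "f \<in> B.Bd n" by (simp add: B.Bd_def)
qed

text \<open>The chain map whose transpose is \<phi> \<mapsto>
  \<open>L.tr \<phi> \<circ> encode\<close>: words with a nondiagonal junction go to zero, and the
  others to their words of loops.\<close>

definition trace :: "(('m \<Rightarrow>\<^sub>0 'k::field) list \<Rightarrow>\<^sub>0 'k) \<Rightarrow> (('m \<Rightarrow>\<^sub>0 'k) list \<Rightarrow>\<^sub>0 'k)" where
  "trace = lin_ext (\<lambda>bs. lin_ext (\<lambda>w. if \<forall>a\<in>set (encode w). fst (fst a) = snd (fst a)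
      then Poly_Mapping.single (map (\<lambda>a. Poly_Mapping.single (snd a) 1) (encode w)) 1 else 0) (expand bs))"

lemma ev_trace: "ev (ml \<phi>) (trace f) = ev (ml (\<lambda>w. L.tr \<phi> (encode w))) f"
proof -
  have "ml \<phi> (map (\<lambda>a. Poly_Mapping.single (snd a) 1) u) = \<phi> (map snd u)" for u :: "(('o \<times> 'o) \<times> 'm) list"
    using ml_basis[of \<phi> "map snd u"] by (simp add: comp_def)
  then have "ev (ml \<phi>) (if \<forall>a\<in>set (encode w). fst (fst a) = snd (fst a)
      then Poly_Mapping.single (map (\<lambda>a. Poly_Mapping.single (snd a) 1) (encode w)) 1 else 0) = L.tr \<phi> (encode w)" for w
    by (simp add: L.tr_def)
  then show ?thesis by (simp only: trace_def ev_lin_ext ev_expand)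
qed

lemma trace_Ch:
  assumes "f \<in> B.Ch n"
  shows "trace f \<in> K.Ch n"
proof -
  have "map (\<lambda>a. Poly_Mapping.single (snd a) 1) (encode w) \<in> K.Tup n" if "w \<in> words (Arr C) n" for w
    using K.map_single_Tup[OF map_snd_words[OF encode_words[OF that]]] by (simp add: comp_def)
  moreover have "Poly_Mapping.keys (expand bs) \<subseteq> words (Arr C) n" if "bs \<in> Poly_Mapping.keys f" for bs
    using assms that keys_expand[of bs "Arr C"] by (fastforce simp: B.Ch_def tuples_def words_def)
  ultimately show ?thesis
    unfolding trace_def K.Ch_def
    by (auto dest!: subsetD[OF keys_lin_ext] split: if_splits) blast+
qed

lemma trace_Cyc:
  assumes f: "f \<in> B.Cyc n"
  shows "trace f \<in> K.Cyc n"
proof -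
  have fC: "f \<in> B.Ch n" using f B.Cyc_Ch by blast
  have "ev (ml (hb (\<lambda>_ _. True) (Comp C) \<phi>)) (trace f) = 0" if "0 < n" "cyclic_cochain loops (n - 1) \<phi>" for \<phi>
  proof -
    have "ev (ml (hb (\<lambda>_ _. True) (Comp C) \<phi>)) (trace f) = ev (ml (hb composable (Comp C) (\<lambda>w. L.tr \<phi> (encode w)))) f"
      unfolding ev_trace by (intro B.ml_cong_Ch[OF _ fC]) (simp add: hb_tr_encode)
    then show ?thesis using f that(1) cyclic_cochain_tr_encode[OF that(2)] by (simp add: B.Cyc_def)
  qed
  then show ?thesis using trace_Ch[OF fC] by (simp add: K.Cyc_def)
qed

text \<open>This gives surjectivity: a groupoid cocycle and the extension of its restriction to
  loops have the same value on every cycle.\<close>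

lemma diff_trace_Bd:
  fixes f :: "('m \<Rightarrow>\<^sub>0 'k::field_char_0) list \<Rightarrow>\<^sub>0 'k"
  assumes f: "f \<in> B.Cyc n"
  shows "f - trace f \<in> B.Bd n"
proof -
  have fC: "f \<in> B.Ch n" using f B.Cyc_Ch by blast
  have "ev (ml \<phi>) (f - trace f) = 0" if \<phi>: "cyclic_cochain (Arr C) n \<phi>" "B.cocycle n \<phi>" for \<phi>
  proof -
    \<comment> \<open>\<open>L.tr \<phi>\<close> uses \<open>\<phi>\<close> only on words of loops,
      so this is the difference between \<open>\<phi>\<close> and the cocycle rebuilt from its
      restriction.\<close>
    let ?\<chi> = "\<lambda>w. \<phi> (decode w) - L.tr \<phi> w"
    let ?E = "\<lambda>\<psi>. ev (ml (\<lambda>w. \<psi> (encode w))) f"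
    have "?E ?\<chi> = 0"
    \<comment> \<open>The start \<open>k = 1\<close> is available because the two cocycles agree on
      words with all junctions at \<open>(x, x)\<close>; \<open>?E\<close> kills coboundaries
      because \<open>f\<close> is a cycle.\<close>
    proof (rule L.cocycle_vanishes[where E = ?E and n = n and k = 1])
      show "?E (\<lambda>u. \<alpha> u - c * \<beta> u) = ?E \<alpha> - c * ?E \<beta>" for \<alpha> \<beta> c
        by (simp add: ev_ml_diff ev_ml_mult)
      show "?E \<alpha> = ?E \<beta>" if "\<And>w. w \<in> words Letters n \<Longrightarrow> \<alpha> w = \<beta> w" for \<alpha> \<beta>
        using that encode_words by (intro B.ml_cong_Ch[OF _ fC]) auto
      show "?E (hb L.lp L.lm \<psi>) = 0" if "0 < n" "cyclic_cochain Letters (n - 1) \<psi>" for \<psi>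
      proof -
        have "?E (hb L.lp L.lm \<psi>) = ev (ml (hb composable (Comp C) (\<lambda>w. \<psi> (encode w)))) f"
          by (intro B.ml_cong_Ch[OF _ fC]) (auto simp: hb_encode words_def)
        then show ?thesis using f that cyclic_cochain_encode by (auto simp: B.Cyc_def)
      qed
      show "cyclic_cochain Letters n ?\<chi>"
        using cyclic_cochain_decode[OF \<phi>(1)] L.cyclic_cochain_tr[OF cyclic_cochain_loops[OF \<phi>(1)]]
        unfolding cyclic_cochain_def by (simp add: algebra_simps)
    next
      fix w assume w: "w \<in> words Letters (Suc n)"
      have "hb composable (Comp C) \<phi> (map snd w) = 0" "hb composable (Comp C) \<phi> (decode w) = 0"
        using \<phi>(2) words_loops map_snd_words[OF w] decode_words[OF w] by (auto simp: B.cocycle_def)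
      moreover from this have "L.tr (hb (\<lambda>_ _. True) (Comp C) \<phi>) w = 0"
        using hb_loops[OF map_snd_words[OF w], of \<phi>] by (simp add: L.tr_def)
      ultimately show "hb L.lp L.lm ?\<chi> w = 0"
        by (simp add: hb_diff hb_decode[OF w] L.hb_tr)
    next
      fix w assume w: "w \<in> words Letters n" "L.nonstar w < 1"
      then have star: "\<forall>a\<in>set w. fst a = (x, x)"
        by (auto simp: L.nonstar_def filter_empty_conv)
      then have "map (Pair (x, x)) (map snd w) = w"
        unfolding map_map by (intro map_idI) (use star in \<open>auto simp: prod_eq_iff\<close>)
      moreover have "encode (map snd w) = map (Pair (x, x)) (map snd w)"
        using map_snd_words[OF w(1)] by (intro encode_loops) (auto simp: words_def)
      ultimately have "decode w = map snd w"
        using decode_encode[of "map snd w" n] words_loops map_snd_words[OF w(1)] by auto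
      then show "?\<chi> w = 0" using star by (simp add: L.tr_def)
    qed simp
    moreover have "?E ?\<chi> = ev (ml (\<lambda>w. \<phi> w - L.tr \<phi> (encode w))) f"
      by (intro B.ml_cong_Ch[OF _ fC]) (simp add: decode_encode)
    ultimately show ?thesis by (simp add: ev_diff ev_trace ev_ml_diff)
  qed
  moreover have "f - trace f \<in> B.Ch n"
    using fC trace_Ch[OF fC] K_Ch_subset by (intro pm.subspace_diff[OF B.subspace_Ch]) auto
  ultimately show ?thesis by (simp add: B.Bd_def)
qed

theorem HC_iso: "HC n (B.A :: ('k::field_char_0, 'm \<Rightarrow>\<^sub>0 'k) kalgebra) \<cong>\<^sub>v HC n (K.A :: ('k, 'm \<Rightarrow>\<^sub>0 'k) kalgebra)"
proof (rule presents_iso[OF B.presents_HC K.presents_HC K_Cyc_subset])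
  show "a \<in> B.Bd n \<longleftrightarrow> a \<in> K.Bd n" if "a \<in> K.Cyc n" for a :: "('m \<Rightarrow>\<^sub>0 'k) list \<Rightarrow>\<^sub>0 'k"
    using that K.Cyc_Ch by (intro Bd_iff) auto
  show "\<exists>b\<in>K.Cyc n. a - b \<in> B.Bd n" if "a \<in> B.Cyc n" for a :: "('m \<Rightarrow>\<^sub>0 'k) list \<Rightarrow>\<^sub>0 'k"
    using trace_Cyc[OF that] diff_trace_Bd[OF that] by blast
qed

end

theorem theorem3p16:
  fixes \<G> :: "('o, 'm) small_category" and x :: 'o
    and B :: "('k::field_char_0, 'm \<Rightarrow>\<^sub>0 'k) kalgebra"
    and KG :: "('k, 'm \<Rightarrow>\<^sub>0 'k) kalgebra"
  assumes "groupoid \<G>" and "connected_category \<G>" and "x \<in> Obj \<G>"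
    and "B = groupoid_algebra \<G>"
    and "KG = group_algebra (loop_group \<G> x)"
  shows "\<forall>n. HC n B \<cong>\<^sub>v HC n KG"
proof -
  interpret groupoid \<G> by fact
  have "\<exists>g h. g \<in> Arr \<G> \<and> Src \<G> g = x \<and> Tgt \<G> g = y \<and> h \<in> Arr \<G> \<and> Src \<G> h = y \<and> Tgt \<G> h = x \<and>
      Comp \<G> h g = Ident \<G> x \<and> Comp \<G> g h = Ident \<G> y \<and> (y = x \<longrightarrow> g = Ident \<G> x \<and> h = Ident \<G> x)"
    if y: "y \<in> Obj \<G>" for y
  \<comment> \<open>At \<open>x\<close> the identity has to be chosen, since connectedness alone
    might supply a nontrivial loop and violate \<open>at_x\<close>.\<close>
  proof (cases "y = x")
    case True
    have "Comp \<G> (Ident \<G> x) (Ident \<G> x) = Ident \<G> x"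
      using Comp_Ident_left[OF Ident_Arr[OF assms(3)]] by (simp add: Tgt_Ident assms(3))
    then show ?thesis
      using True assms(3) by (intro exI[of _ "Ident \<G> x"]) (auto simp: Ident_Arr Src_Ident Tgt_Ident)
  next
    case False
    obtain g where "g \<in> Arr \<G>" "Src \<G> g = x" "Tgt \<G> g = y"
      using assms(2,3) y by (auto simp: connected_category_def)
    with inverse[of g] False show ?thesis by blast
  qed
  then obtain from_x to_x where paths: "\<And>y. y \<in> Obj \<G> \<Longrightarrow>
      from_x y \<in> Arr \<G> \<and> Src \<G> (from_x y) = x \<and> Tgt \<G> (from_x y) = y \<and>
      to_x y \<in> Arr \<G> \<and> Src \<G> (to_x y) = y \<and> Tgt \<G> (to_x y) = x \<and>
      Comp \<G> (to_x y) (from_x y) = Ident \<G> x \<and> Comp \<G> (from_x y) (to_x y) = Ident \<G> y \<and>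
      (y = x \<longrightarrow> from_x y = Ident \<G> x \<and> to_x y = Ident \<G> x)"
    by metis
  interpret based_groupoid \<G> x from_x to_x
    by unfold_locales (use paths assms(3) in auto)
  have "B = B.A"
    unfolding assms(4) groupoid_algebra_def B.A_def ..
  moreover have "KG = K.A"
    unfolding assms(5) group_algebra_def K.A_def by (simp add: loop_group_def loops_def)
  ultimately show ?thesis by (simp add: HC_iso)
qed

end
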